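(* Let $P\subseteq \mathrm{GL}(n,\mathbb{F}_q)$ be the standard parabolic subgroup of type $(n_1,\dots,n_s)$ with all block orders $n_k\le 2$. Then: 1) for any $\lambda\in J^*$ there exists a rook placement $D$ in $\Delta_J$ such that $\lambda$ is equivalent to $\lambda_D$; 2) for rook placements $D,D'$ in $\Delta_J$, the elements $\lambda_D$ and $\lambda_{D'}$ are equivalent if and only if $D$ and $D'$ are conjugate with respect to the action of $W_R$ on $\Delta_J$.
   Context: $\mathbb{F}_q$ is a finite field, $n=n_1+\dots+n_s$, and $\{1,\dots,n\}$ is divided into consecutive segments $I_1,\dots,I_s$ of sizes $n_1,\dots,n_s$. The standard parabolic subgroup of type $(n_1,\dots,n_s)$ is the group $P$ of invertible block upper triangular matrices with diagonal blocks of sizes $n_1,\dots,n_s$. $P=RN$, where $R=R_1\times\dots\times R_s$, $R_k=\mathrm{GL}(n_k,\mathbb{F}_q)$, is the block-diagonal subgroup and $N=1+J$, with $J$ the algebra of strictly block upper triangular matrices. Put $\Delta_J=\bigcup_{1\le k<\ell\le s} I_k\times I_\ell$; its elements are called roots; $\{E_\alpha:\alpha\in\Delta_J\}$ (matrix units) is a basis of $J$ and $\{E^*_\alpha:\alpha\in\Delta_J\}$ is the dual basis of the dual space $J^*$. The Weyl group $W_R=S_{I_1}\times\dots\times S_{I_s}$ of $R$ acts on $\Delta_J$ by $w(i,j)=(w(i),w(j))$. $P$ acts on $J^*$ on the left and on the right by $(g\lambda)(x)=\lambda(xg)$ and $(\lambda g)(x)=\lambda(gx)$. Elements $\lambda,\lambda'\in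 J^*$ are equivalent if there exist $r\in R$ and $a,b\in N$ such that $\lambda'=ra\lambda br^{-1}$, i.e. $\lambda'(x)=\lambda(br^{-1}xra)$ for all $x\in J$. A rook placement is a subset $D\subseteq\Delta_J$ with at most one root in each row and at most one root in each column (the root $(i,j)$ lies in row $i$ and column $j$). Put $\lambda_D=\sum_{\alpha\in D}E^*_\alpha$. *)

theory Defs
  imports
    "Jordan_Normal_Form.Matrix"
    "HOL-Library.FuncSet"
    "HOL-Combinatorics.Permutations"
begin

text \<open>
  A type \<open>(n\<^sub>1, \<dots>, n\<^sub>s)\<close> is a list \<open>ns\<close> of positive numbers. Rows, columns and segments are
  numbered from \<open>0\<close>, so \<open>{1, \<dots>, n}\<close> becomes \<open>{0..<sum_list ns}\<close> and the segments are
  \<open>segment ns k\<close> for \<open>k < length ns\<close>.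
\<close>

definition segment :: "nat list \<Rightarrow> nat \<Rightarrow> nat set" where
  "segment ns k = {sum_list (take k ns) ..< sum_list (take (Suc k) ns)}"

definition roots :: "nat list \<Rightarrow> (nat \<times> nat) set" where
  "roots ns = (\<Union>l<length ns. \<Union>k<l. segment ns k \<times> segment ns l)"

definition diag_positions :: "nat list \<Rightarrow> (nat \<times> nat) set" where
  "diag_positions ns = (\<Union>k<length ns. segment ns k \<times> segment ns k)"

definition supported_on :: "'a::zero mat \<Rightarrow> (nat \<times> nat) set \<Rightarrow> bool" where
  "supported_on x S \<longleftrightarrow> (\<forall>i<dim_row x. \<forall>j<dim_col x. x $$ (i, j) \<noteq> 0 \<longrightarrow> (i, j) \<in> S)"

abbreviation mat_ring :: "nat \<Rightarrow> 'a::field mat ring" where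
  "mat_ring n \<equiv> ring_mat TYPE('a) n ()"

definition GL :: "nat \<Rightarrow> 'a::field mat set" where
  "GL n = Units (mat_ring n)"

definition parabolic :: "nat list \<Rightarrow> 'a::field mat set" where
  "parabolic ns = {g \<in> GL (sum_list ns). supported_on g (diag_positions ns \<union> roots ns)}"

definition levi :: "nat list \<Rightarrow> 'a::field mat set" where
  "levi ns = {g \<in> parabolic ns. supported_on g (diag_positions ns)}"

definition nilradical :: "nat list \<Rightarrow> 'a::field mat set" where
  "nilradical ns = {x \<in> carrier_mat (sum_list ns) (sum_list ns). supported_on x (roots ns)}"

definition unipotent_radical :: "nat list \<Rightarrow> 'a::field mat set" where
  "unipotent_radical ns = (\<lambda>x. 1\<^sub>m (sum_list ns) + x) ` nilradical ns"

text \<open>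
  Elements of the dual space \<open>J\<^sup>*\<close> are extensional functions on \<open>J\<close>, so that two functionals
  are equal as HOL functions iff they agree on \<open>J\<close>.
\<close>

definition dual :: "nat list \<Rightarrow> ('a::field mat \<Rightarrow> 'a) set" where
  "dual ns = {f \<in> extensional (nilradical ns).
     (\<forall>x\<in>nilradical ns. \<forall>y\<in>nilradical ns. f (x + y) = f x + f y) \<and>
     (\<forall>c. \<forall>x\<in>nilradical ns. f (c \<cdot>\<^sub>m x) = c * f x)}"

definition left_act :: "nat list \<Rightarrow> 'a::field mat \<Rightarrow> ('a mat \<Rightarrow> 'a) \<Rightarrow> 'a mat \<Rightarrow> 'a" where
  "left_act ns g f = (\<lambda>x\<in>nilradical ns. f (x * g))"

definition right_act :: "nat list \<Rightarrow> ('a::field mat \<Rightarrow> 'a) \<Rightarrow> 'a mat \<Rightarrow> 'a mat \<Rightarrow> 'a" where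
  "right_act ns f g = (\<lambda>x\<in>nilradical ns. f (g * x))"

definition equivalent :: "nat list \<Rightarrow> ('a::field mat \<Rightarrow> 'a) \<Rightarrow> ('a mat \<Rightarrow> 'a) \<Rightarrow> bool" where
  "equivalent ns f f' \<longleftrightarrow>
     (\<exists>r\<in>levi ns. \<exists>a\<in>unipotent_radical ns. \<exists>b\<in>unipotent_radical ns.
        f' = left_act ns (r * a) (right_act ns f (b * inv\<^bsub>mat_ring (sum_list ns)\<^esub> r)))"

definition matrix_unit :: "nat list \<Rightarrow> nat \<times> nat \<Rightarrow> 'a::field mat" where
  "matrix_unit ns \<alpha> = mat (sum_list ns) (sum_list ns) (\<lambda>\<beta>. if \<beta> = \<alpha> then 1 else 0)"

text \<open>
  The functionals dual to the matrix units are the coordinate functions; the lemmas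
  \<open>dual_unit_in_dual\<close> and \<open>dual_unit_matrix_unit\<close> below justify this.
\<close>

definition dual_unit :: "nat list \<Rightarrow> nat \<times> nat \<Rightarrow> 'a::field mat \<Rightarrow> 'a" where
  "dual_unit ns \<alpha> = (\<lambda>x\<in>nilradical ns. x $$ \<alpha>)"

definition rook_placement :: "nat list \<Rightarrow> (nat \<times> nat) set \<Rightarrow> bool" where
  "rook_placement ns D \<longleftrightarrow> D \<subseteq> roots ns \<and>
     (\<forall>i j j'. (i, j) \<in> D \<and> (i, j') \<in> D \<longrightarrow> j = j') \<and>
     (\<forall>i i' j. (i, j) \<in> D \<and> (i', j) \<in> D \<longrightarrow> i = i')"

definition rook_functional :: "nat list \<Rightarrow> (nat \<times> nat) set \<Rightarrow> 'a::field mat \<Rightarrow> 'a" where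
  "rook_functional ns D = (\<lambda>x\<in>nilradical ns. \<Sum>\<alpha>\<in>D. dual_unit ns \<alpha> x)"

definition levi_weyl :: "nat list \<Rightarrow> (nat \<Rightarrow> nat) set" where
  "levi_weyl ns = {w. w permutes {..<sum_list ns} \<and>
     (\<forall>k<length ns. w ` segment ns k = segment ns k)}"

definition weyl_conjugate :: "nat list \<Rightarrow> (nat \<times> nat) set \<Rightarrow> (nat \<times> nat) set \<Rightarrow> bool" where
  "weyl_conjugate ns D D' \<longleftrightarrow> (\<exists>w\<in>levi_weyl ns. D' = map_prod w w ` D)"

lemma segment_subset: "k < length ns \<Longrightarrow> segment ns k \<subseteq> {..<sum_list ns}"
proof -
  assume "k < length ns"
  have "sum_list ns = sum_list (take (Suc k) ns) + sum_list (drop (Suc k) ns)"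
    by (metis append_take_drop_id sum_list_append)
  then show ?thesis by (auto simp: segment_def)
qed

lemma roots_subset: "roots ns \<subseteq> {..<sum_list ns} \<times> {..<sum_list ns}"
proof
  fix x assume "x \<in> roots ns"
  then obtain k l where kl: "k < l" "l < length ns" and x: "x \<in> segment ns k \<times> segment ns l"
    unfolding roots_def by blast
  have "segment ns k \<subseteq> {..<sum_list ns}" "segment ns l \<subseteq> {..<sum_list ns}"
    using kl by (auto intro!: segment_subset)
  with x show "x \<in> {..<sum_list ns} \<times> {..<sum_list ns}" by blast
qed

lemma matrix_unit_in_nilradical: "\<alpha> \<in> roots ns \<Longrightarrow> matrix_unit ns \<alpha> \<in> nilradical ns"
  by (auto simp: matrix_unit_def nilradical_def supported_on_def split: if_splits)

lemma dual_unit_in_dual: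
  assumes "\<alpha> \<in> roots ns"
  shows "dual_unit ns \<alpha> \<in> dual ns"
proof -
  obtain i j where \<alpha>: "\<alpha> = (i, j)" by (cases \<alpha>)
  have ij: "i < sum_list ns" "j < sum_list ns" using assms roots_subset[of ns] \<alpha> by auto
  have "x + y \<in> nilradical ns" if "x \<in> nilradical ns" "y \<in> nilradical ns" for x y :: "'a mat"
  proof -
    have x: "x \<in> carrier_mat (sum_list ns) (sum_list ns)"
      and y: "y \<in> carrier_mat (sum_list ns) (sum_list ns)"
      using that by (auto simp: nilradical_def)
    have "(k, l) \<in> roots ns"
      if kl: "k < sum_list ns" "l < sum_list ns" and nz: "x $$ (k, l) + y $$ (k, l) \<noteq> 0" for k l
    proof -
      have "x $$ (k, l) \<noteq> 0 \<or> y $$ (k, l) \<noteq> 0"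
        using nz by (cases "x $$ (k, l) = 0") simp_all
      then show ?thesis
        using kl x y \<open>x \<in> nilradical ns\<close> \<open>y \<in> nilradical ns\<close>
        by (auto simp: nilradical_def supported_on_def)
    qed
    then show ?thesis using x y by (simp add: nilradical_def supported_on_def)
  qed
  moreover have "c \<cdot>\<^sub>m x \<in> nilradical ns" if "x \<in> nilradical ns" for c and x :: "'a mat"
    using that by (auto simp: nilradical_def supported_on_def)
  ultimately show ?thesis
    using ij by (auto simp: \<alpha> dual_def dual_unit_def nilradical_def)
qed

lemma dual_unit_matrix_unit:
  assumes "\<alpha> \<in> roots ns" "\<beta> \<in> roots ns"
  shows "dual_unit ns \<alpha> (matrix_unit ns \<beta>) = (if \<alpha> = \<beta> then 1 else 0)"
proof -
  obtain i j where \<alpha>: "\<alpha> = (i, j)" by (cases \<alpha>)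
  have "i < sum_list ns" "j < sum_list ns" using assms roots_subset[of ns] \<alpha> by auto
  then show ?thesis
    using matrix_unit_in_nilradical[OF assms(2)] by (auto simp: \<alpha> dual_unit_def matrix_unit_def)
qed

end

(*
  The trace form identifies J^* with matrices modulo block upper triangular ones, and then X, Y are
  equivalent iff p X = Y q modulo block upper triangular matrices for some p, q in P with the same
  diagonal blocks.

  Existence: Gaussian elimination brings X to the form g M with g in R and M a rook matrix. Each block of g
  is made monomial by the Bruhat decomposition of GL(2): the left transvection is
  pushed through M to later blocks, the right one is absorbed, sliding through M and g to earlier
  blocks. A diagonal matrix scales the monomial matrix g M to a rook matrix.

  Uniqueness: some w in W_R meets only nonzero entries of the common diagonal part of p and q. Comparing entries
  of p M = M' q, w can only lower the block heights of the rooks; summing over all rows and using symmetry,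
  it preserves them. Only two rooks in a common pair of blocks can be mismatched, and then w is
  corrected by a transposition.
*)
theory Submission
  imports Defs "Jordan_Normal_Form.Determinant"
begin

text \<open>The obstacle is that \<open>p\<close> and \<open>q\<close> must have the same diagonal
  blocks. For independent \<open>p\<close> and \<open>q\<close> in P elimination would finish the
  job; restoring the common diagonal part costs the factor \<open>g\<close>, and a row operation
  inside a block now forces the matching column operation. Such a transvection can therefore be
  removed only by following it until it dies or lands in a block that is still to be treated. The
  rooks dictate which of its two orientations can be removed. This is where small blocks enter: a
  block of order two has one pair of indices, and a single transvection on each side, of whatever
  orientation, is enough to make an invertible 2 x 2 block monomial. Blocks are treated in
  increasing order, so that sliding uses only monomial blocks and side effects hit only untreated
  ones.

  In the uniqueness part, order at most two means that two rooks sharing both their row block and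
  their column block fill these blocks completely. A mismatch is then a crossing, and the comparison
  of entries itself shows that the entries needed for the swap are nonzero.\<close>

text \<open>As a destruction rule, \<open>carrier_matD\<close> lets \<open>auto\<close> eliminate the variable \<open>n\<close> in favour of \<open>dim_row A\<close>.\<close>

declare carrier_matD [rule del] carrier_matI [rule del]

lemma mat_mult_entry:
  assumes "A \<in> carrier_mat n m" "B \<in> carrier_mat m k" "i < n" "j < k"
  shows "(A * B) $$ (i, j) = (\<Sum>l<m. A $$ (i, l) * B $$ (l, j))"
  using assms by (simp add: scalar_prod_def atLeast0LessThan)

lemma finite_carrier_mat: "finite (carrier_mat n m :: 'a::finite mat set)"
proof -
  have "A \<in> mat n m ` (({..<n} \<times> {..<m}) \<rightarrow>\<^sub>E UNIV)" if A: "A \<in> carrier_mat n m" for A :: "'a mat"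
  proof (rule image_eqI)
    show "A = mat n m (restrict (\<lambda>x. A $$ x) ({..<n} \<times> {..<m}))"
    proof (rule eq_matI)
      fix i j assume "i < dim_row (mat n m (restrict (\<lambda>x. A $$ x) ({..<n} \<times> {..<m})))"
        "j < dim_col (mat n m (restrict (\<lambda>x. A $$ x) ({..<n} \<times> {..<m})))"
      then have "(i, j) \<in> {..<n} \<times> {..<m}" by (simp only: dim_row_mat dim_col_mat) simp
      then show "A $$ (i, j) = mat n m (restrict (\<lambda>x. A $$ x) ({..<n} \<times> {..<m})) $$ (i, j)"
        by (metis index_mat(1) lessThan_iff mem_Sigma_iff restrict_apply')
    qed (use A in auto)
  qed simp
  then have "(carrier_mat n m :: 'a mat set) \<subseteq> mat n m ` (({..<n} \<times> {..<m}) \<rightarrow>\<^sub>E UNIV)"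
    by blast
  moreover have "finite (({..<n} \<times> {..<m}) \<rightarrow>\<^sub>E (UNIV :: 'a set))"
    by (simp add: finite_PiE)
  ultimately show ?thesis by (meson finite_imageI finite_subset)
qed

lemma mat_inverse_unique:
  fixes p p' h :: "'a::comm_ring_1 mat"
  assumes "p \<in> carrier_mat n n" "p' \<in> carrier_mat n n" "h \<in> carrier_mat n n"
    and "p' * p = 1\<^sub>m n" "p * h = 1\<^sub>m n"
  shows "h = p'"
proof -
  have "h = (p' * p) * h" using assms by simp
  also have "\<dots> = p' * (p * h)" by (rule assoc_mult_mat[OF assms(2,1,3)])
  finally show ?thesis using assms by simp
qed

section \<open>The parabolic subgroup, its projection onto R, and equivalence of matrices\<close>

locale blocked =
  fixes n :: nat and blk :: "nat \<Rightarrow> nat"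
  assumes blk_mono: "i \<le> j \<Longrightarrow> j < n \<Longrightarrow> blk i \<le> blk j"
begin

definition upper :: "'a::{field,finite} mat set" where
  "upper = {p \<in> carrier_mat n n. \<forall>i<n. \<forall>j<n. blk j < blk i \<longrightarrow> p $$ (i, j) = 0}"

text \<open>The inverse is only required to be a matrix, in agreement with the units of the full
  matrix ring; that it is again block upper triangular is \<open>par_inverse\<close>.\<close>

definition par :: "'a::{field,finite} mat set" where
  "par = {p \<in> upper. \<exists>p' \<in> carrier_mat n n. p * p' = 1\<^sub>m n \<and> p' * p = 1\<^sub>m n}"

definition block_diag :: "'a::{field,finite} mat set" where
  "block_diag = {p \<in> par. \<forall>i<n. \<forall>j<n. blk i \<noteq> blk j \<longrightarrow> p $$ (i, j) = 0}"

definition dg :: "'a::{field,finite} mat \<Rightarrow> 'a mat" where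
  "dg p = mat n n (\<lambda>(i, j). if blk i = blk j then p $$ (i, j) else 0)"

definition low_eq :: "'a::{field,finite} mat \<Rightarrow> 'a mat \<Rightarrow> bool" where
  "low_eq X Y \<longleftrightarrow> (\<forall>i<n. \<forall>j<n. blk j < blk i \<longrightarrow> X $$ (i, j) = Y $$ (i, j))"

text \<open>With \<open>p = r a\<close> and \<open>q = r b^-1\<close> this is
  \<open>Y = r a X b r^-1\<close> modulo block upper triangular matrices, cleared of inverses on the
  sides of \<open>X\<close> and \<open>Y\<close>; \<open>dg p = dg q\<close> records the common
  \<open>r\<close>.\<close>

definition eqv :: "'a::{field,finite} mat \<Rightarrow> 'a mat \<Rightarrow> bool" where
  "eqv X Y \<longleftrightarrow> (\<exists>p\<in>par. \<exists>q\<in>par. dg p = dg q \<and> low_eq (p * X) (Y * q))"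

lemma upper_carrier: "p \<in> upper \<Longrightarrow> p \<in> carrier_mat n n"
  and par_upper: "p \<in> par \<Longrightarrow> p \<in> upper"
  and block_diag_par: "p \<in> block_diag \<Longrightarrow> p \<in> par"
  by (auto simp: upper_def par_def block_diag_def)

lemma par_carrier [simp]: "p \<in> par \<Longrightarrow> p \<in> carrier_mat n n"
  using par_upper upper_carrier by blast

lemma block_diag_carrier [simp]: "p \<in> block_diag \<Longrightarrow> p \<in> carrier_mat n n"
  using block_diag_par par_carrier by blast

lemma sq_assoc:
  "A \<in> carrier_mat n n \<Longrightarrow> B \<in> carrier_mat n n \<Longrightarrow> C \<in> carrier_mat n n
    \<Longrightarrow> A * B * C = A * (B * C)"
  by (rule assoc_mult_mat)

lemma sq_simps [simp]:
  fixes A B :: "'a::semiring_1 mat"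
  shows "A \<in> carrier_mat n n \<Longrightarrow> 1\<^sub>m n * A = A"
  "A \<in> carrier_mat n n \<Longrightarrow> A * 1\<^sub>m n = A"
  "A \<in> carrier_mat n n \<Longrightarrow> B \<in> carrier_mat n n \<Longrightarrow> A * B \<in> carrier_mat n n"
  by auto

lemma cancel_inverse:
  fixes p p' X :: "'a::semiring_1 mat"
  assumes "p \<in> carrier_mat n n" "p' \<in> carrier_mat n n" "X \<in> carrier_mat n n" "p' * p = 1\<^sub>m n"
  shows "p' * (p * X) = X"
  using assms sq_assoc[of p' p X] by simp

lemma dg_carrier [simp]: "dg p \<in> carrier_mat n n"
  by (simp add: dg_def)

lemma upper_mult:
  assumes "p \<in> upper" "q \<in> upper" shows "p * q \<in> upper"
proof -
  have c: "p \<in> carrier_mat n n" "q \<in> carrier_mat n n" using assms upper_carrier by auto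
  have "(p * q) $$ (i, j) = 0" if "i < n" "j < n" "blk j < blk i" for i j
  proof -
    have "p $$ (i, l) * q $$ (l, j) = 0" if "l < n" for l
      using assms that \<open>i < n\<close> \<open>j < n\<close> \<open>blk j < blk i\<close> unfolding upper_def
      by (cases "blk l < blk i") auto
    then have "(\<Sum>l<n. p $$ (i, l) * q $$ (l, j)) = 0" by (intro sum.neutral) auto
    then show ?thesis using that c by (simp add: mat_mult_entry[OF c] del: index_mult_mat)
  qed
  then show ?thesis using c by (simp add: upper_def del: index_mult_mat)
qed

lemma one_upper [simp]: "1\<^sub>m n \<in> upper"
  by (auto simp: upper_def)

text \<open>Left multiplication by \<open>p\<close> is injective on the finite set of block upper triangular matrices, hence surjective.\<close>

lemma par_inverse:
  assumes "p \<in> par"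
  obtains p' where "p' \<in> par" "p * p' = 1\<^sub>m n" "p' * p = 1\<^sub>m n"
proof -
  obtain p' where p': "p' \<in> carrier_mat n n" "p * p' = 1\<^sub>m n" "p' * p = 1\<^sub>m n"
    using assms unfolding par_def by blast
  have pc: "p \<in> carrier_mat n n" using assms by simp
  have fin: "finite (upper :: 'a mat set)"
    by (rule finite_subset[OF _ finite_carrier_mat]) (auto simp: upper_def)
  have inj: "inj_on ((*) p) upper"
  proof (rule inj_onI)
    fix x y assume "x \<in> upper" "y \<in> upper" and eq: "p * x = p * y"
    then have c: "x \<in> carrier_mat n n" "y \<in> carrier_mat n n" by (auto simp: upper_carrier)
    show "x = y" using eq p' pc c by (metis cancel_inverse)
  qed
  have "(*) p ` upper \<subseteq> upper"
    by (rule image_subsetI) (rule upper_mult[OF par_upper[OF assms]])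
  from endo_inj_surj[OF fin this inj] have "(*) p ` upper = upper" .
  then have "1\<^sub>m n \<in> (*) p ` upper" by (simp only: one_upper)
  then obtain h where h: "h \<in> upper" "p * h = 1\<^sub>m n" by (elim imageE) (metis)
  have "h = p'"
    by (rule mat_inverse_unique[OF pc p'(1) upper_carrier[OF h(1)] p'(3) h(2)])
  then have "p' \<in> par" unfolding par_def using h p' pc by blast
  then show thesis using p' that by blast
qed

lemma par_mult: assumes "p \<in> par" "q \<in> par" shows "p * q \<in> par"
proof -
  obtain p' where p': "p' \<in> par" "p * p' = 1\<^sub>m n" "p' * p = 1\<^sub>m n" using par_inverse assms by blast
  obtain q' where q': "q' \<in> par" "q * q' = 1\<^sub>m n" "q' * q = 1\<^sub>m n" using par_inverse assms by blast
  have c: "p \<in> carrier_mat n n" "q \<in> carrier_mat n n" "p' \<in> carrier_mat n n" "q' \<in> carrier_mat n n"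
    using assms p' q' by auto
  have 1: "(p * q) * (q' * p') = 1\<^sub>m n"
    using c p' q' by (simp add: sq_assoc cancel_inverse)
  have 2: "(q' * p') * (p * q) = 1\<^sub>m n"
    using c p' q' by (simp add: sq_assoc cancel_inverse)
  have "q' * p' \<in> carrier_mat n n" using c by simp
  then show ?thesis unfolding par_def using 1 2 assms upper_mult par_upper by blast
qed

lemma one_par [simp]: "1\<^sub>m n \<in> par"
  unfolding par_def using one_upper by (auto intro: bexI[of _ "1\<^sub>m n"])

lemma dg_one [simp]: "dg (1\<^sub>m n) = 1\<^sub>m n"
  by (rule eq_matI) (auto simp: dg_def)

text \<open>For \<open>i\<close> and \<open>j\<close> in one block, a term whose middle index lies
  outside that block has a factor below the block diagonal. So \<open>dg\<close> is the projection
  of P onto R, with kernel N.\<close>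

lemma dg_mult:
  assumes "p \<in> upper" "q \<in> upper" shows "dg (p * q) = dg p * dg q"
proof (rule eq_matI)
  have c: "p \<in> carrier_mat n n" "q \<in> carrier_mat n n" using assms upper_carrier by auto
  show "dim_row (dg (p * q)) = dim_row (dg p * dg q)" "dim_col (dg (p * q)) = dim_col (dg p * dg q)"
    by (simp_all add: dg_def)
  fix i j assume "i < dim_row (dg p * dg q)" "j < dim_col (dg p * dg q)"
  then have ij: "i < n" "j < n" by (auto simp: dg_def)
  have "dg (p * q) $$ (i, j) = (if blk i = blk j then \<Sum>l<n. p $$ (i, l) * q $$ (l, j) else 0)"
    using ij c by (simp add: dg_def mat_mult_entry[OF c] del: index_mult_mat)
  also have "\<dots> = (\<Sum>l<n. dg p $$ (i, l) * dg q $$ (l, j))"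
  proof (cases "blk i = blk j")
    case True
    have "p $$ (i, l) * q $$ (l, j) = dg p $$ (i, l) * dg q $$ (l, j)" if "l < n" for l
      using that ij True assms unfolding upper_def
      by (cases "blk l" "blk i" rule: linorder_cases) (auto simp: dg_def)
    then show ?thesis using True by simp
  next
    case False
    then have "(\<Sum>l<n. dg p $$ (i, l) * dg q $$ (l, j)) = 0"
      using ij by (intro sum.neutral) (auto simp: dg_def)
    then show ?thesis using False by simp
  qed
  also have "\<dots> = (dg p * dg q) $$ (i, j)"
    using ij by (simp add: mat_mult_entry[OF dg_carrier dg_carrier] del: index_mult_mat)
  finally show "dg (p * q) $$ (i, j) = (dg p * dg q) $$ (i, j)" .
qed

lemma dg_block_diag: "p \<in> block_diag \<Longrightarrow> dg p = p"
  by (rule eq_matI) (auto simp: dg_def block_diag_def dest!: par_carrier)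

lemma dg_in_block_diag:
  assumes "p \<in> par" shows "dg p \<in> block_diag"
proof -
  obtain p' where p': "p' \<in> par" "p * p' = 1\<^sub>m n" "p' * p = 1\<^sub>m n" using par_inverse assms by blast
  have "dg p * dg p' = 1\<^sub>m n" "dg p' * dg p = 1\<^sub>m n"
    using p' assms by (metis dg_mult dg_one par_upper)+
  moreover have "dg p \<in> upper" by (simp add: upper_def) (simp add: dg_def)
  ultimately have "dg p \<in> par" unfolding par_def using dg_carrier by blast
  then show ?thesis unfolding block_diag_def by (simp add: dg_def)
qed

lemma block_diag_iff: "p \<in> block_diag \<longleftrightarrow> p \<in> par \<and> dg p = p"
  by (metis dg_block_diag block_diag_par dg_in_block_diag)

lemma block_diag_mult: "p \<in> block_diag \<Longrightarrow> q \<in> block_diag \<Longrightarrow> p * q \<in> block_diag"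
  by (simp add: block_diag_iff par_mult dg_mult par_upper)

lemma dg_eq_inverse:
  assumes "p \<in> par" "q \<in> par" "dg p = dg q" "p' \<in> par" "q' \<in> par"
    and "p * p' = 1\<^sub>m n" "q' * q = 1\<^sub>m n"
  shows "dg p' = dg q'"
proof (rule mat_inverse_unique)
  show "dg q' * dg q = 1\<^sub>m n" using assms by (metis dg_mult dg_one par_upper)
  show "dg q * dg p' = 1\<^sub>m n" using assms by (metis dg_mult dg_one par_upper)
qed auto

lemma block_diag_inverse:
  assumes "p \<in> block_diag"
  obtains p' where "p' \<in> block_diag" "p * p' = 1\<^sub>m n" "p' * p = 1\<^sub>m n"
proof -
  obtain p' where p': "p' \<in> par" "p * p' = 1\<^sub>m n" "p' * p = 1\<^sub>m n"
    using par_inverse assms block_diag_par by blast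
  have "dg p' = p'"
  proof (rule mat_inverse_unique[of p])
    show "p * dg p' = 1\<^sub>m n"
      using dg_mult[of p p'] p' assms by (simp add: block_diag_iff par_upper)
  qed (use p' assms in auto)
  then show thesis using p' that by (auto simp: block_diag_iff)
qed

lemma low_eq_refl [simp]: "low_eq X X" by (simp add: low_eq_def)
lemma low_eq_sym: "low_eq X Y \<Longrightarrow> low_eq Y X" by (simp add: low_eq_def)
lemma low_eq_trans [trans]: "low_eq X Y \<Longrightarrow> low_eq Y Z \<Longrightarrow> low_eq X Z" by (simp add: low_eq_def)

text \<open>Row \<open>i\<close> of \<open>p\<close> meets only rows \<open>l\<close> with
  \<open>blk l \<ge> blk i\<close>, so an entry of the product below the block diagonal depends only
  on entries of \<open>X\<close> below it. Together with the right-hand version this makes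
  \<open>low_eq\<close> a congruence for multiplication by P.\<close>

lemma low_eq_mult_left:
  assumes "low_eq X Y" "p \<in> upper" "X \<in> carrier_mat n n" "Y \<in> carrier_mat n n"
  shows "low_eq (p * X) (p * Y)"
  unfolding low_eq_def
proof (intro allI impI)
  fix i j assume ij: "i < n" "j < n" "blk j < blk i"
  have "p $$ (i, l) * X $$ (l, j) = p $$ (i, l) * Y $$ (l, j)" if "l < n" for l
    using assms(1,2) that ij unfolding low_eq_def upper_def by (cases "blk l < blk i") auto
  then have "(\<Sum>l<n. p $$ (i, l) * X $$ (l, j)) = (\<Sum>l<n. p $$ (i, l) * Y $$ (l, j))" by (intro sum.cong) auto
  then show "(p * X) $$ (i, j) = (p * Y) $$ (i, j)" using assms(2-4) ij
    by (simp add: mat_mult_entry[of _ n n _ n] upper_carrier del: index_mult_mat)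
qed

lemma low_eq_mult_right:
  assumes "low_eq X Y" "p \<in> upper" "X \<in> carrier_mat n n" "Y \<in> carrier_mat n n"
  shows "low_eq (X * p) (Y * p)"
  unfolding low_eq_def
proof (intro allI impI)
  fix i j assume ij: "i < n" "j < n" "blk j < blk i"
  have "X $$ (i, l) * p $$ (l, j) = Y $$ (i, l) * p $$ (l, j)" if "l < n" for l
    using assms(1,2) that ij unfolding low_eq_def upper_def by (cases "blk l < blk i") auto
  then have "(\<Sum>l<n. X $$ (i, l) * p $$ (l, j)) = (\<Sum>l<n. Y $$ (i, l) * p $$ (l, j))" by (intro sum.cong) auto
  then show "(X * p) $$ (i, j) = (Y * p) $$ (i, j)" using assms(2-4) ij
    by (simp add: mat_mult_entry[of _ n n _ n] upper_carrier del: index_mult_mat)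
qed

lemma eqv_low_eq: "low_eq X Y \<Longrightarrow> X \<in> carrier_mat n n \<Longrightarrow> Y \<in> carrier_mat n n \<Longrightarrow> eqv X Y"
  unfolding eqv_def by (auto intro!: bexI[of _ "1\<^sub>m n"])

lemma eqv_refl: "X \<in> carrier_mat n n \<Longrightarrow> eqv X X"
  by (simp add: eqv_low_eq)

lemma eqv_sym:
  assumes "eqv X Y" "X \<in> carrier_mat n n" "Y \<in> carrier_mat n n" shows "eqv Y X"
proof -
  obtain p q where pq: "p \<in> par" "q \<in> par" "dg p = dg q" and l: "low_eq (p * X) (Y * q)"
    using assms by (auto simp: eqv_def)
  obtain p' where p': "p' \<in> par" "p * p' = 1\<^sub>m n" "p' * p = 1\<^sub>m n" using par_inverse pq by blast
  obtain q' where q': "q' \<in> par" "q * q' = 1\<^sub>m n" "q' * q = 1\<^sub>m n" using par_inverse pq by blast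
  have c: "p \<in> carrier_mat n n" "q \<in> carrier_mat n n" "p' \<in> carrier_mat n n" "q' \<in> carrier_mat n n"
    using pq p' q' by auto
  have "low_eq (p' * (p * X) * q') (p' * (Y * q) * q')"
    using l c p' q' assms(2,3) by (intro low_eq_mult_right low_eq_mult_left par_upper) auto
  moreover have "p' * (p * X) * q' = X * q'"
    using c assms(2,3) p' by (simp add: cancel_inverse)
  moreover have "p' * (Y * q) * q' = p' * Y"
    using c assms(2,3) q' by (simp add: sq_assoc)
  ultimately have "low_eq (p' * Y) (X * q')"
    using c assms(2,3) p' q' by (simp add: low_eq_sym)
  moreover have "dg p' = dg q'" using dg_eq_inverse pq p' q' by blast
  ultimately show ?thesis using p' q' by (auto simp: eqv_def)
qed

lemma eqv_trans:
  assumes "eqv X Y" "eqv Y Z" "X \<in> carrier_mat n n" "Y \<in> carrier_mat n n" "Z \<in> carrier_mat n n"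
  shows "eqv X Z"
proof -
  obtain p q where pq: "p \<in> par" "q \<in> par" "dg p = dg q" and l: "low_eq (p * X) (Y * q)"
    using assms by (auto simp: eqv_def)
  obtain p' q' where pq': "p' \<in> par" "q' \<in> par" "dg p' = dg q'" and l': "low_eq (p' * Y) (Z * q')"
    using assms by (auto simp: eqv_def)
  have c: "p \<in> carrier_mat n n" "q \<in> carrier_mat n n" "p' \<in> carrier_mat n n" "q' \<in> carrier_mat n n"
    using pq pq' by auto
  have "low_eq (p' * (p * X)) (p' * (Y * q))"
    by (rule low_eq_mult_left[OF l]) (use pq' c assms(3-5) par_upper in auto)
  moreover have "low_eq ((p' * Y) * q) ((Z * q') * q)"
    by (rule low_eq_mult_right[OF l']) (use pq c assms(3-5) par_upper in auto)
  ultimately have "low_eq ((p' * p) * X) (Z * (q' * q))"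
    using c assms(3-5) low_eq_trans[of "p' * (p * X)" "p' * (Y * q)" "Z * (q' * q)"]
    by (simp add: sq_assoc)
  moreover have "dg (p' * p) = dg (q' * q)"
    using pq pq' by (simp add: dg_mult par_upper)
  ultimately show ?thesis using pq pq' par_mult by (auto simp: eqv_def)
qed

text \<open>Taking \<open>p = q = r\<close> cycles a block diagonal factor from one end to the
  other. With \<open>eqv_left\<close> and \<open>eqv_right\<close>, which discard factors of N at
  the ends, this is the source of the moves in the reduction.\<close>

lemma eqv_conj:
  assumes "r \<in> block_diag" "X \<in> carrier_mat n n" shows "eqv (X * r) (r * X)"
  unfolding eqv_def using assms block_diag_par
  by (intro bexI[of _ r] conjI) (auto simp: sq_assoc)

lemma eqv_left:
  assumes "a \<in> par" "dg a = 1\<^sub>m n" "X \<in> carrier_mat n n" shows "eqv X (a * X)"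
  unfolding eqv_def using assms by (intro bexI[of _ a] bexI[of _ "1\<^sub>m n"] conjI) auto

lemma eqv_right:
  assumes "b \<in> par" "dg b = 1\<^sub>m n" "X \<in> carrier_mat n n" shows "eqv (X * b) X"
  unfolding eqv_def using assms by (intro bexI[of _ b] bexI[of _ "1\<^sub>m n"] conjI) auto

end

subsection \<open>Transvections and Gaussian elimination\<close>

text \<open>Distinct powers of two with exponents below \<open>f s\<close> add up to less than
  \<open>2 ^ f s\<close>, so losing \<open>s\<close> outweighs gaining all of
  \<open>A\<close>.\<close>

lemma sum_power2_decrease:
  fixes f :: "'b \<Rightarrow> nat"
  assumes "finite S" "s \<in> S" "S' \<subseteq> (S - {s}) \<union> A" "finite A" "inj_on f A" "\<And>a. a \<in> A \<Longrightarrow> f a < f s"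
  shows "(\<Sum>a\<in>S'. 2 ^ f a) < (\<Sum>a\<in>S. (2::nat) ^ f a)"
proof -
  have "(\<Sum>a\<in>A. (2::nat) ^ f a) = (\<Sum>k\<in>f ` A. 2 ^ k)"
    using assms by (simp add: sum.reindex)
  also have "\<dots> \<le> (\<Sum>k<f s. 2 ^ k)"
    using assms by (intro sum_mono2) auto
  also have "\<dots> < 2 ^ f s"
    by (simp only: lessThan_def mask_eq_sum_exp_nat[symmetric]) simp
  finally have A: "(\<Sum>a\<in>A. (2::nat) ^ f a) < 2 ^ f s" .
  have "(\<Sum>a\<in>S'. (2::nat) ^ f a) \<le> (\<Sum>a\<in>(S - {s}) \<union> A. 2 ^ f a)"
    using assms by (intro sum_mono2) auto
  also have "\<dots> \<le> (\<Sum>a\<in>S - {s}. 2 ^ f a) + (\<Sum>a\<in>A. 2 ^ f a)"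
    using assms(1,4) by (subst sum_Un_nat) auto
  also have "\<dots> < (\<Sum>a\<in>S - {s}. 2 ^ f a) + 2 ^ f s" using A by simp
  also have "\<dots> = (\<Sum>a\<in>S. 2 ^ f a)"
    using assms by (simp add: sum.remove)
  finally show ?thesis .
qed

text \<open>\<open>col\<close> and \<open>row\<close> say that no column operation to the right and
  no row operation upwards has anything left to kill. Going outwards from the bottom left corner,
  every element is lowest in its column and leftmost in its row: an element below or to the left
  would be nearer to the corner, hence a pivot, and would exclude the given one.\<close>

lemma reduced_imp_rook:
  fixes S :: "nat \<Rightarrow> nat \<Rightarrow> bool"
  assumes bound: "\<And>i j. S i j \<Longrightarrow> i < n"
    and col: "\<And>i j j'. S i j \<Longrightarrow> (\<And>i'. i < i' \<Longrightarrow> \<not> S i' j) \<Longrightarrow> j < j' \<Longrightarrow> \<not> S i j'"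
    and row: "\<And>i j i'. S i j \<Longrightarrow> (\<And>j'. j' < j \<Longrightarrow> \<not> S i j') \<Longrightarrow> i' < i \<Longrightarrow> \<not> S i' j"
    and "S i j"
  shows "(\<forall>i'. S i' j \<longrightarrow> i' = i) \<and> (\<forall>j'. S i j' \<longrightarrow> j' = j)"
proof -
  have "(\<forall>i'>i. \<not> S i' j) \<and> (\<forall>j'<j. \<not> S i j')" if "S i j" for i j
    using that
  proof (induction "n - i + j" arbitrary: i j rule: less_induct)
    case less
    have "\<not> S i' j" if "i < i'" for i'
    proof
      assume s: "S i' j"
      then have "n - i' + j < n - i + j" using that bound[OF s] by linarith
      from less(1)[OF this s] show False using row[OF s, of i] that less(2) by blast
    qed
    moreover have "\<not> S i j'" if "j' < j" for j'
    proof
      assume s: "S i j'"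
      then have "n - i + j' < n - i + j" using that by linarith
      from less(1)[OF this s] show False using col[OF s, of j] that less(2) by blast
    qed
    ultimately show ?case by blast
  qed
  with \<open>S i j\<close> show ?thesis by (metis linorder_neqE_nat)
qed

text \<open>Zero rows and columns are permitted: this is a rook matrix up to nonzero
  scalars.\<close>

definition monomial :: "'a::zero mat \<Rightarrow> bool" where
  "monomial X \<longleftrightarrow> (\<forall>i<dim_row X. \<forall>j<dim_col X. X $$ (i, j) \<noteq> 0 \<longrightarrow>
     (\<forall>i'<dim_row X. X $$ (i', j) \<noteq> 0 \<longrightarrow> i' = i) \<and> (\<forall>j'<dim_col X. X $$ (i, j') \<noteq> 0 \<longrightarrow> j' = j))"

context blocked
begin

text \<open>On the left it adds \<open>x\<close> times row \<open>b\<close> to row \<open>a\<close>;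
  on the right it adds \<open>x\<close> times column \<open>a\<close> to column
  \<open>b\<close>.\<close>

definition tv :: "nat \<Rightarrow> nat \<Rightarrow> 'a::{field,finite} \<Rightarrow> 'a mat" where
  "tv a b x = mat n n (\<lambda>(i, j). (if i = j then 1 else 0) + (if i = a \<and> j = b then x else 0))"

lemma tv_carrier [simp]: "tv a b x \<in> carrier_mat n n"
  by (simp add: tv_def)

lemma tv_mult_left:
  assumes "X \<in> carrier_mat n n" "b < n" "i < n" "j < n"
  shows "(tv a b x * X) $$ (i, j) = X $$ (i, j) + (if i = a then x * X $$ (b, j) else 0)"
proof -
  have "(tv a b x * X) $$ (i, j) = (\<Sum>l<n. (if i = l then X $$ (l, j) else 0)
      + (if b = l then if i = a then x * X $$ (l, j) else 0 else 0))"
    unfolding mat_mult_entry[OF tv_carrier assms(1,3,4)]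
    using assms by (intro sum.cong) (auto simp: tv_def algebra_simps)
  then show ?thesis using assms by (simp add: sum.distrib)
qed

lemma tv_mult_right:
  assumes "X \<in> carrier_mat n n" "a < n" "i < n" "j < n"
  shows "(X * tv a b x) $$ (i, j) = X $$ (i, j) + (if j = b then X $$ (i, a) * x else 0)"
proof -
  have "(X * tv a b x) $$ (i, j) = (\<Sum>l<n. (if j = l then X $$ (i, l) else 0)
      + (if a = l then if j = b then X $$ (i, l) * x else 0 else 0))"
    unfolding mat_mult_entry[OF assms(1) tv_carrier assms(3,4)]
    using assms by (intro sum.cong) (auto simp: tv_def algebra_simps)
  then show ?thesis using assms by (simp add: sum.distrib)
qed

lemma tv_inverse:
  assumes "a < n" "b < n" "a \<noteq> b" shows "tv a b x * tv a b (- x) = 1\<^sub>m n"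
proof (rule eq_matI)
  fix i j assume "i < dim_row (1\<^sub>m n :: 'a mat)" "j < dim_col (1\<^sub>m n :: 'a mat)"
  then have "i < n" "j < n" by simp_all
  then show "(tv a b x * tv a b (- x)) $$ (i, j) = (1\<^sub>m n :: 'a mat) $$ (i, j)"
    unfolding tv_mult_left[OF tv_carrier assms(2) \<open>i < n\<close> \<open>j < n\<close>]
    using assms by (auto simp: tv_def)
qed (simp_all add: tv_def)

lemma tv_par:
  assumes "a < n" "b < n" "a \<noteq> b" "blk a \<le> blk b" shows "tv a b x \<in> par"
proof -
  have "tv a b x * tv a b (- x) = 1\<^sub>m n" "tv a b (- x) * tv a b x = 1\<^sub>m n"
    using tv_inverse[OF assms(1-3), of x] tv_inverse[OF assms(1-3), of "- x"] by simp_all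
  moreover have "tv a b x \<in> upper" using assms by (auto simp: upper_def tv_def)
  ultimately show ?thesis unfolding par_def by (auto intro: bexI[of _ "tv a b (- x)"])
qed

lemma tv_dg:
  assumes "blk a < blk b" shows "dg (tv a b x) = 1\<^sub>m n"
  by (rule eq_matI) (use assms in \<open>auto simp: dg_def tv_def\<close>)

lemma tv_block_diag:
  assumes "a < n" "b < n" "a \<noteq> b" "blk a = blk b" shows "tv a b x \<in> block_diag"
  using tv_par[OF assms(1-3)] assms by (auto simp: block_diag_def tv_def)

definition supp :: "'a::{field,finite} mat \<Rightarrow> (nat \<times> nat) set" where
  "supp X = {(i, j). i < n \<and> j < n \<and> X $$ (i, j) \<noteq> 0}"

text \<open>The weights grow downwards and to the left so fast that one killed entry outweighs all entries above it
  (after a column operation) and all entries to its right (after a row operation).\<close>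

definition weight :: "'a::{field,finite} mat \<Rightarrow> nat" where
  "weight X = (\<Sum>(i, j)\<in>supp X. 2 ^ (i + (n - j)))"

lemma finite_supp: "finite (supp X)"
  by (rule finite_subset[of _ "{..<n} \<times> {..<n}"]) (auto simp: supp_def)

lemma weight_decrease:
  assumes "(i, j) \<in> supp X" "supp Y \<subseteq> (supp X - {(i, j)}) \<union> A" "finite A"
    and "inj_on (\<lambda>(i, j). i + (n - j)) A"
    and "\<And>a b. (a, b) \<in> A \<Longrightarrow> a + (n - b) < i + (n - j)"
  shows "weight Y < weight X"
proof -
  have "(\<Sum>a\<in>supp Y. 2 ^ (\<lambda>(i, j). i + (n - j)) a) < (\<Sum>a\<in>supp X. (2::nat) ^ (\<lambda>(i, j). i + (n - j)) a)"
    using assms by (intro sum_power2_decrease[OF finite_supp assms(1)]) auto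
  then show ?thesis by (simp add: weight_def case_prod_unfold)
qed

text \<open>The pivot is the lowest entry of its column, so besides killing \<open>(i, j')\<close>
  the operation creates entries only above it in column \<open>j'\<close>.\<close>

lemma weight_column_op:
  assumes X: "X \<in> carrier_mat n n" and ij: "(i, j) \<in> supp X" and "(i, j') \<in> supp X" "j < j'"
    and bot: "\<And>i'. i < i' \<Longrightarrow> (i', j) \<notin> supp X"
  shows "weight (X * tv j j' (- X $$ (i, j') / X $$ (i, j))) < weight X"
proof (rule weight_decrease)
  have lt: "i < n" "j < n" "j' < n" "X $$ (i, j) \<noteq> 0" using assms by (auto simp: supp_def)
  let ?A = "(\<lambda>i'. (i', j')) ` {..<i}"
  show "(i, j') \<in> supp X" "finite ?A" using assms by auto
  show "inj_on (\<lambda>(i, j). i + (n - j)) ?A" by (auto simp: inj_on_def)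
  show "a + (n - b) < i + (n - j')" if "(a, b) \<in> ?A" for a b using that by auto
  show "supp (X * tv j j' (- X $$ (i, j') / X $$ (i, j))) \<subseteq> (supp X - {(i, j')}) \<union> ?A"
  proof (rule subsetI)
    fix c assume c: "c \<in> supp (X * tv j j' (- X $$ (i, j') / X $$ (i, j)))"
    then obtain a b where ab: "c = (a, b)" "a < n" "b < n" by (auto simp: supp_def)
    have nz: "X $$ (a, b) + (if b = j' then X $$ (a, j) * (- X $$ (i, j') / X $$ (i, j)) else 0) \<noteq> 0"
      using c ab unfolding tv_mult_right[OF X lt(2) ab(2,3), symmetric]
      by (simp add: supp_def del: index_mult_mat)
    show "c \<in> (supp X - {(i, j')}) \<union> ?A"
    proof (cases "b = j' \<and> a \<le> i")
      case True
      then show ?thesis using nz lt ab by (cases "a = i") auto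
    next
      case False
      then have "X $$ (a, b) \<noteq> 0" using nz bot[of a] ab lt by (auto simp: supp_def split: if_splits)
      then show ?thesis using False ab by (auto simp: supp_def)
    qed
  qed
qed

text \<open>The pivot is leftmost in its row, so new entries arise only to the right of the killed
  one.\<close>

lemma weight_row_op:
  assumes X: "X \<in> carrier_mat n n" and ij: "(i, j) \<in> supp X" and "(i', j) \<in> supp X" "i' < i"
    and left: "\<And>j'. j' < j \<Longrightarrow> (i, j') \<notin> supp X"
  shows "weight (tv i' i (- X $$ (i', j) / X $$ (i, j)) * X) < weight X"
proof (rule weight_decrease)
  have lt: "i < n" "j < n" "i' < n" "X $$ (i, j) \<noteq> 0" using assms by (auto simp: supp_def)
  let ?A = "(\<lambda>j'. (i', j')) ` {j<..<n}"
  show "(i', j) \<in> supp X" "finite ?A" using assms by auto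
  show "inj_on (\<lambda>(i, j). i + (n - j)) ?A" by (auto simp: inj_on_def)
  show "a + (n - b) < i' + (n - j)" if "(a, b) \<in> ?A" for a b using that by auto
  show "supp (tv i' i (- X $$ (i', j) / X $$ (i, j)) * X) \<subseteq> (supp X - {(i', j)}) \<union> ?A"
  proof (rule subsetI)
    fix c assume c: "c \<in> supp (tv i' i (- X $$ (i', j) / X $$ (i, j)) * X)"
    then obtain a b where ab: "c = (a, b)" "a < n" "b < n" by (auto simp: supp_def)
    have nz: "X $$ (a, b) + (if a = i' then (- X $$ (i', j) / X $$ (i, j)) * X $$ (i, b) else 0) \<noteq> 0"
      using c ab unfolding tv_mult_left[OF X lt(1) ab(2,3), symmetric]
      by (simp add: supp_def del: index_mult_mat)
    show "c \<in> (supp X - {(i', j)}) \<union> ?A"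
    proof (cases "a = i' \<and> j \<le> b")
      case True
      then show ?thesis using nz lt ab by (cases "b = j") auto
    next
      case False
      then have "X $$ (a, b) \<noteq> 0" using nz left[of b] ab lt by (auto simp: supp_def split: if_splits)
      then show ?thesis using False ab by (auto simp: supp_def)
    qed
  qed
qed

text \<open>Instead of running the elimination, a matrix of least weight is chosen in the double
  coset \<open>P X P\<close>. Adding columns to the right and rows upwards is multiplication by
  upper triangular matrices, which lie in P whatever the blocks are.\<close>

lemma par_monomial_form:
  assumes X: "X \<in> carrier_mat n n"
  obtains p q where "p \<in> par" "q \<in> par" "monomial (p * X * q)"
proof -
  define Q where "Q Y \<longleftrightarrow> (\<exists>p\<in>par. \<exists>q\<in>par. Y = p * X * q)" for Y
  have "Q X" unfolding Q_def using X by (auto intro!: bexI[of _ "1\<^sub>m n"])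
  then obtain Y where Y: "Q Y" and min: "\<And>Z. Q Z \<Longrightarrow> weight Y \<le> weight Z"
    using ex_has_least_nat[of Q X weight] by blast
  obtain p q where pq: "p \<in> par" "q \<in> par" "Y = p * X * q" using Y by (auto simp: Q_def)
  have Yc: "Y \<in> carrier_mat n n" using pq X by simp
  have Qr: "Q (Y * t)" if t: "t \<in> par" for t
  proof -
    have "Y * t = p * X * (q * t)" using pq X t by (simp add: sq_assoc)
    then show ?thesis using pq t par_mult unfolding Q_def by blast
  qed
  have Ql: "Q (t * Y)" if t: "t \<in> par" for t
  proof -
    have "t * Y = t * p * X * q" using pq X t by (simp add: sq_assoc)
    then show ?thesis using pq t par_mult unfolding Q_def by blast
  qed
  have col: "(i, j') \<notin> supp Y" if "(i, j) \<in> supp Y" "\<And>i'. i < i' \<Longrightarrow> (i', j) \<notin> supp Y" "j < j'" for i j j'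
  proof
    assume a: "(i, j') \<in> supp Y"
    have "tv j j' (- Y $$ (i, j') / Y $$ (i, j)) \<in> par"
      using a that(3) blk_mono[of j j'] by (intro tv_par) (auto simp: supp_def)
    from min[OF Qr[OF this]] weight_column_op[OF Yc that(1) a that(3,2)] show False by simp
  qed
  have row: "(i', j) \<notin> supp Y" if "(i, j) \<in> supp Y" "\<And>j'. j' < j \<Longrightarrow> (i, j') \<notin> supp Y" "i' < i" for i j i'
  proof
    assume a: "(i', j) \<in> supp Y"
    have "tv i' i (- Y $$ (i', j) / Y $$ (i, j)) \<in> par"
      using a that(1,3) blk_mono[of i' i] by (intro tv_par) (auto simp: supp_def)
    from min[OF Ql[OF this]] weight_row_op[OF Yc that(1) a that(3,2)] show False by simp
  qed
  have "(\<forall>i'. (i', j) \<in> supp Y \<longrightarrow> i' = i) \<and> (\<forall>j'. (i, j') \<in> supp Y \<longrightarrow> j' = j)"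
    if "(i, j) \<in> supp Y" for i j
  proof (rule reduced_imp_rook[of "\<lambda>i j. (i, j) \<in> supp Y" n i j])
    show "i < n" if "(i, j) \<in> supp Y" for i j using that by (simp add: supp_def)
  qed (fact col, fact row, fact that)
  then have "monomial Y" using Yc by (auto simp: monomial_def supp_def)
  then show thesis using pq that by blast
qed

end

subsection \<open>Rook matrices times block diagonal matrices\<close>

context blocked
begin

definition rook :: "(nat \<times> nat) set \<Rightarrow> bool" where
  "rook D \<longleftrightarrow> (\<forall>(i, j)\<in>D. i < n \<and> j < n \<and> blk i < blk j) \<and>
     (\<forall>i j j'. (i, j) \<in> D \<and> (i, j') \<in> D \<longrightarrow> j = j') \<and>
     (\<forall>i i' j. (i, j) \<in> D \<and> (i', j) \<in> D \<longrightarrow> i = i')"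

text \<open>The root \<open>(i, j)\<close> sits at position \<open>(j, i)\<close>, because \<open>E\<^sup>*\<^sub>i\<^sub>j\<close> is the functional \<open>x \<mapsto> tr (E\<^sub>j\<^sub>i x)\<close>.\<close>

definition rmat :: "(nat \<times> nat) set \<Rightarrow> 'a::{field,finite} mat" where
  "rmat D = mat n n (\<lambda>(i, j). if (j, i) \<in> D then 1 else 0)"

lemma rmat_carrier [simp]: "rmat D \<in> carrier_mat n n"
  by (simp add: rmat_def)

lemma rmat_entry: "i < n \<Longrightarrow> j < n \<Longrightarrow> rmat D $$ (i, j) = (if (j, i) \<in> D then 1 else 0)"
  by (simp add: rmat_def)

lemma rookD:
  assumes "rook D" "(i, j) \<in> D"
  shows "i < n" "j < n" "blk i < blk j" "(i, j') \<in> D \<longleftrightarrow> j' = j" "(i', j) \<in> D \<longleftrightarrow> i' = i"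
  using assms unfolding rook_def by blast+

lemma sq_eqI:
  assumes "A \<in> carrier_mat n n" "B \<in> carrier_mat n n"
    and "\<And>i j. i < n \<Longrightarrow> j < n \<Longrightarrow> A $$ (i, j) = B $$ (i, j)"
  shows "A = B"
  by (rule eq_matI) (use assms in auto)

text \<open>\<open>E_ab * rmat D\<close> and \<open>rmat D * E_ij\<close> are both the matrix unit
  \<open>E_aj\<close>: a transvection of two rows passes to the columns of their rooks.\<close>

lemma tv_rmat:
  assumes "rook D" "(i, a) \<in> D" "(j, b) \<in> D"
  shows "tv a b x * rmat D = rmat D * tv i j x"
proof (rule sq_eqI)
  note l = rookD[OF assms(1,2)] rookD[OF assms(1,3)]
  fix r c assume rc: "r < n" "c < n"
  show "(tv a b x * rmat D) $$ (r, c) = (rmat D * tv i j x) $$ (r, c)"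
    unfolding tv_mult_left[OF rmat_carrier l(7) rc] tv_mult_right[OF rmat_carrier l(1) rc]
    using rc l by (simp add: rmat_entry)
qed simp_all

lemma tv_rmat_id:
  assumes "b < n" "\<And>i. (i, b) \<notin> D" shows "tv a b x * rmat D = rmat D"
proof (rule sq_eqI)
  fix r c assume rc: "r < n" "c < n"
  show "(tv a b x * rmat D) $$ (r, c) = (rmat D :: 'a mat) $$ (r, c)"
    unfolding tv_mult_left[OF rmat_carrier assms(1) rc] using rc assms by (simp add: rmat_entry)
qed simp_all

lemma rmat_tv_id:
  assumes "a < n" "\<And>i. (a, i) \<notin> D" shows "rmat D * tv a b x = rmat D"
proof (rule sq_eqI)
  fix r c assume rc: "r < n" "c < n"
  show "(rmat D * tv a b x) $$ (r, c) = (rmat D :: 'a mat) $$ (r, c)"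
    unfolding tv_mult_right[OF rmat_carrier assms(1) rc] using rc assms by (simp add: rmat_entry)
qed simp_all

text \<open>Here \<open>E_ab * g\<close> is \<open>g $$ (b, d)\<close> times \<open>E_ad\<close>,
  and \<open>g * E_cd\<close> is \<open>g $$ (a, c)\<close> times \<open>E_ad\<close>; the quotient
  of the two entries is the factor on \<open>x\<close>.\<close>

lemma tv_commute:
  assumes g: "g \<in> carrier_mat n n" and l: "a < n" "b < n" "c < n" "d < n" and "g $$ (a, c) \<noteq> 0"
    and col: "\<And>r. r < n \<Longrightarrow> g $$ (r, c) \<noteq> 0 \<Longrightarrow> r = a"
    and row: "\<And>s. s < n \<Longrightarrow> g $$ (b, s) \<noteq> 0 \<Longrightarrow> s = d"
  shows "tv a b x * g = g * tv c d (x * g $$ (b, d) / g $$ (a, c))"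
proof (rule sq_eqI)
  fix r s assume rs: "r < n" "s < n"
  have row0: "g $$ (b, s) = 0" if "s \<noteq> d" using row[OF rs(2)] that by blast
  have col0: "g $$ (r, c) = 0" if "r \<noteq> a" using col[OF rs(1)] that by blast
  show "(tv a b x * g) $$ (r, s) = (g * tv c d (x * g $$ (b, d) / g $$ (a, c))) $$ (r, s)"
    unfolding tv_mult_left[OF g l(2) rs] tv_mult_right[OF g l(3) rs]
    using row0 col0 assms(6) by (cases "r = a"; cases "s = d") simp_all
qed (use g in simp_all)

text \<open>Cycling \<open>g\<close> to the right end exposes the transvection as a factor of N on
  the left, where it is dropped; then \<open>g\<close> is cycled back.\<close>

lemma eqv_absorb_root:
  assumes "g \<in> block_diag" "M \<in> carrier_mat n n" "a < n" "b < n" "blk a < blk b"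
  shows "eqv (g * (tv a b x * M)) (g * M)"
proof -
  have t: "tv a b x \<in> par" "dg (tv a b x) = 1\<^sub>m n" using assms by (auto intro: tv_par tv_dg)
  have "eqv (g * (tv a b x * M)) (tv a b x * (M * g))"
    using eqv_conj[OF assms(1), of "tv a b x * M"] assms by (simp add: sq_assoc eqv_sym)
  moreover have "eqv (tv a b x * (M * g)) (M * g)"
    using eqv_left[OF t, of "M * g"] assms by (simp add: eqv_sym)
  moreover have "eqv (M * g) (g * M)" using eqv_conj assms by blast
  ultimately show ?thesis
    using eqv_trans[of "g * (tv a b x * M)" "tv a b x * (M * g)" "M * g"]
      eqv_trans[of "g * (tv a b x * M)" "M * g" "g * M"] assms by simp
qed

text \<open>Blocks are numbered from 0, so these are the blocks \<open>0, ..., m - 1\<close> that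
  the reduction has already made monomial.\<close>

definition mono_below :: "'a::{field,finite} mat \<Rightarrow> nat \<Rightarrow> bool" where
  "mono_below g m \<longleftrightarrow> (\<forall>i<n. \<forall>j<n. blk i < m \<longrightarrow> g $$ (i, j) \<noteq> 0 \<longrightarrow>
     (\<forall>i'<n. g $$ (i', j) \<noteq> 0 \<longrightarrow> i' = i) \<and> (\<forall>j'<n. g $$ (i, j') \<noteq> 0 \<longrightarrow> j' = j))"

lemma mono_below_le:
  assumes "mono_below g m" "k \<le> m" shows "mono_below g k"
  unfolding mono_below_def
proof (rule allI, rule impI, rule allI, rule impI, rule impI, rule impI)
  fix i j assume "i < n" "j < n" "blk i < k" "g $$ (i, j) \<noteq> 0"
  moreover from this have "blk i < m" using assms(2) by simp
  ultimately show "(\<forall>i'<n. g $$ (i', j) \<noteq> 0 \<longrightarrow> i' = i) \<and> (\<forall>j'<n. g $$ (i, j') \<noteq> 0 \<longrightarrow> j' = j)"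
    using assms(1) unfolding mono_below_def by blast
qed

lemma par_row_nonzero:
  assumes "g \<in> par" "i < n" obtains j where "j < n" "g $$ (i, j) \<noteq> 0"
proof -
  obtain g' where g': "g' \<in> par" "g * g' = 1\<^sub>m n" using par_inverse assms(1) by blast
  have "(\<Sum>l<n. g $$ (i, l) * g' $$ (l, i)) = 1"
    using mat_mult_entry[of g n n g' n i i] par_carrier[OF assms(1)] par_carrier[OF g'(1)] assms(2)
    unfolding g'(2) by simp
  then have "(\<Sum>l<n. g $$ (i, l) * g' $$ (l, i)) \<noteq> 0" by simp
  then obtain l where "l \<in> {..<n}" "g $$ (i, l) * g' $$ (l, i) \<noteq> 0"
    by (rule sum.not_neutral_contains_not_neutral)
  then have "l < n" "g $$ (i, l) \<noteq> 0" by simp_all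
  then show thesis by (rule that)
qed

lemma block_diag_entry:
  "g \<in> block_diag \<Longrightarrow> i < n \<Longrightarrow> j < n \<Longrightarrow> g $$ (i, j) \<noteq> 0 \<Longrightarrow> blk i = blk j"
  by (auto simp: block_diag_def)

text \<open>One link of the chain: \<open>g * tv a b x * rmat D\<close> equals
  \<open>g * rmat D * tv i j x\<close>, cycling gives \<open>tv i j x * g * rmat D\<close>, and
  monomiality of \<open>g\<close> in the block of \<open>i\<close> and \<open>j\<close> turns this
  into \<open>g * tv c d y * rmat D\<close> for a scaled parameter \<open>y\<close>.\<close>

lemma absorb_transfer:
  assumes D: "rook D" and g: "g \<in> block_diag" "mono_below g m"
    and ia: "(i, a) \<in> D" and jb: "(j, b) \<in> D" and blk: "blk i = blk j" "blk i < m" and ne: "a \<noteq> b"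
    and c: "c < n" "g $$ (i, c) \<noteq> 0" and d: "d < n" "g $$ (j, d) \<noteq> 0"
    and IH: "\<And>x. eqv (g * (tv c d x * rmat D)) (g * rmat D)"
  shows "eqv (g * (tv a b x * rmat D)) (g * rmat D)"
proof -
  note l = rookD[OF D ia] rookD[OF D jb]
  have gc: "g \<in> carrier_mat n n" using g by simp
  have "i \<noteq> j" using l ne ia jb by auto
  then have t: "tv i j x \<in> block_diag" using tv_block_diag l blk by auto
  have comm: "tv i j x * g = g * tv c d (x * g $$ (j, d) / g $$ (i, c))"
  proof (rule tv_commute[OF gc l(1) l(6) c(1) d(1) c(2)])
    show "r = i" if "r < n" "g $$ (r, c) \<noteq> 0" for r
      using g(2) that c blk l unfolding mono_below_def by blast
    show "s = d" if "s < n" "g $$ (j, s) \<noteq> 0" for s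
      using g(2) that d blk l unfolding mono_below_def by metis
  qed
  have "g * (tv a b x * rmat D) = g * rmat D * tv i j x"
    using tv_rmat[OF D ia jb, of x] gc by (simp add: sq_assoc)
  moreover have "tv i j x * (g * rmat D) = g * (tv c d (x * g $$ (j, d) / g $$ (i, c)) * rmat D)"
    using comm gc by (simp add: sq_assoc[symmetric])
  ultimately have "eqv (g * (tv a b x * rmat D)) (g * (tv c d (x * g $$ (j, d) / g $$ (i, c)) * rmat D))"
    using eqv_conj[OF t, of "g * rmat D"] gc by simp
  from eqv_trans[OF this IH] show ?thesis using gc by simp
qed

text \<open>A transvection of one block slides through \<open>rmat D\<close> to the block of the columns involved and then through
  \<open>g\<close>, until it meets an empty row or a pair of columns in different blocks. Which of
  the two orientations of the transvection can be absorbed is only known at the end of this chain.\<close>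

lemma absorb_orientation:
  fixes g :: "'a::{field,finite} mat"
  assumes D: "rook D" and g: "g \<in> block_diag"
  shows "mono_below g m \<Longrightarrow> a < n \<Longrightarrow> b < n \<Longrightarrow> a \<noteq> b \<Longrightarrow> blk a = m \<Longrightarrow> blk b = m \<Longrightarrow>
    (\<forall>x. eqv (g * (tv a b x * rmat D)) (g * rmat D)) \<or>
    (\<forall>x. eqv (g * (tv b a x * rmat D)) (g * rmat D))"
proof (induction m arbitrary: a b rule: less_induct)
  case (less m)
  have gc: "g \<in> carrier_mat n n" using g by simp
  show ?case
  proof (cases "(\<exists>i. (i, a) \<in> D) \<and> (\<exists>j. (j, b) \<in> D)")
    case False
    then have "(\<nexists>i. (i, a) \<in> D) \<or> (\<nexists>j. (j, b) \<in> D)" by blast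
    then show ?thesis
    proof
      assume "\<nexists>i. (i, a) \<in> D"
      then have "tv b a x * rmat D = rmat D" for x :: 'a using less.prems by (intro tv_rmat_id) auto
      then show ?thesis using gc by (simp add: eqv_refl)
    next
      assume "\<nexists>j. (j, b) \<in> D"
      then have "tv a b x * rmat D = rmat D" for x :: 'a using less.prems by (intro tv_rmat_id) auto
      then show ?thesis using gc by (simp add: eqv_refl)
    qed
  next
    case True
    then obtain i j where ij: "(i, a) \<in> D" "(j, b) \<in> D" by blast
    note l = rookD[OF D ij(1)] rookD[OF D ij(2)]
    \<comment> \<open>At the right end the transvection has become \<open>tv u v x\<close>, a factor
      of N as soon as \<open>blk u < blk v\<close>. The order of the column blocks thus decides the
      orientation.\<close>
    have shift: "eqv (g * (tv r s x * rmat D)) (g * rmat D)"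
      if "(u, r) \<in> D" "(v, s) \<in> D" "blk u < blk v" for u v r s x
    proof -
      have uv: "u < n" "v < n" using rookD[OF D] that by blast+
      have "g * (tv r s x * rmat D) = g * rmat D * tv u v x"
        using tv_rmat[OF D that(1,2), of x] gc by (simp add: sq_assoc)
      moreover have "tv u v x \<in> par" using that uv by (intro tv_par) auto
      ultimately show ?thesis
        using eqv_right[of "tv u v x" "g * rmat D"] tv_dg[OF that(3), of x] gc by simp
    qed
    consider "blk i < blk j" | "blk j < blk i" | "blk i = blk j" by linarith
    then show ?thesis
    proof cases
      case 3
      obtain c where c: "c < n" "g $$ (i, c) \<noteq> 0" using par_row_nonzero[of g i] block_diag_par g l by auto
      obtain d where d: "d < n" "g $$ (j, d) \<noteq> 0" using par_row_nonzero[of g j] block_diag_par g l by auto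
      have cd: "blk c = blk i" "blk d = blk i" using block_diag_entry[OF g] c d l 3 by metis+
      \<comment> \<open>A rook lies strictly below the block diagonal, so each link of the chain
        lowers the block index and the chain ends.\<close>
      have lt: "blk i < m" using l less.prems by simp
      have "i \<noteq> j" using l ij less.prems by auto
      then have "c \<noteq> d" using less.prems(1) lt c d l unfolding mono_below_def by metis
      moreover have "mono_below g (blk i)" using mono_below_le[OF less.prems(1)] lt by simp
      ultimately have "(\<forall>x. eqv (g * (tv c d x * rmat D)) (g * rmat D)) \<or>
          (\<forall>x. eqv (g * (tv d c x * rmat D)) (g * rmat D))"
        using less.IH[OF lt, of c d] c d cd by blast
      then show ?thesis
        using absorb_transfer[OF D g less.prems(1) ij 3 lt less.prems(4) c d]
          absorb_transfer[OF D g less.prems(1) ij(2,1) 3[symmetric] _ less.prems(4)[symmetric] d c]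
          lt 3 by auto
    qed (use shift ij in blast)+
  qed
qed

text \<open>Cycling the factor to the right end and sliding it back through \<open>rmat D\<close>
  gives a transvection of the rows of the two rooks. The orientation is chosen to make it block
  upper triangular: it is then dropped as a factor of N or merged into a later block of
  \<open>h\<close>. An empty column ends the slide at once. The choice depends on \<open>D\<close>
  and the block alone, so it can be made before \<open>h\<close> and \<open>x\<close> are
  known.\<close>

lemma push_orientation:
  assumes D: "rook D" and ab: "a < n" "b < n" "a \<noteq> b" "blk a = m" "blk b = m"
  obtains c d where "{c, d} = {a, b}" "c \<noteq> d"
    "\<And>(h :: 'a::{field,finite} mat) (x :: 'a). h \<in> block_diag \<Longrightarrow> \<exists>h'\<in>block_diag.
       eqv (tv c d x * (h * rmat D)) (h' * rmat D) \<and>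
       (\<forall>r<n. \<forall>s<n. blk r \<le> m \<longrightarrow> h' $$ (r, s) = h $$ (r, s))"
proof -
  note orient = that
  have conj: "eqv (tv c d x * (h * rmat D)) (h * (rmat D * tv c d x))"
    if "h \<in> block_diag" "{c, d} = {a, b}" "c \<noteq> d" for h :: "'a mat" and c d and x :: 'a
  proof -
    have "tv c d x \<in> block_diag" using that ab by (intro tv_block_diag) (auto simp: doubleton_eq_iff)
    from eqv_sym[OF eqv_conj[OF this, of "h * rmat D"]] show ?thesis
      using that by (simp add: sq_assoc)
  qed
  have zero: thesis if cd: "{c, d} = {a, b}" "c \<noteq> d" and z: "\<And>r. (c, r) \<notin> D" for c d
  proof (rule orient[OF cd])
    fix h :: "'a mat" and x :: 'a assume h: "h \<in> block_diag"
    have "rmat D * tv c d x = rmat D" using rmat_tv_id z cd ab by (metis doubleton_eq_iff)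
    then show "\<exists>h'\<in>block_diag. eqv (tv c d x * (h * rmat D)) (h' * rmat D) \<and>
       (\<forall>r<n. \<forall>s<n. blk r \<le> m \<longrightarrow> h' $$ (r, s) = h $$ (r, s))"
      using conj[OF h cd, of x] h by auto
  qed
  have both: thesis if cd: "{c, d} = {a, b}" "c \<noteq> d" and rs: "(c, r) \<in> D" "(d, s) \<in> D" and le: "blk r \<le> blk s"
    for c d r s
  proof (rule orient[OF cd])
    fix h :: "'a mat" and x :: 'a assume h: "h \<in> block_diag"
    note l = rookD[OF D rs(1)] rookD[OF D rs(2)]
    have eq: "eqv (tv c d x * (h * rmat D)) (h * (tv r s x * rmat D))"
      using conj[OF h cd, of x] tv_rmat[OF D rs, of x] by simp
    have ne: "r \<noteq> s" using l rs cd by auto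
    have c: "h \<in> carrier_mat n n" using h by simp
    show "\<exists>h'\<in>block_diag. eqv (tv c d x * (h * rmat D)) (h' * rmat D) \<and>
       (\<forall>r<n. \<forall>s<n. blk r \<le> m \<longrightarrow> h' $$ (r, s) = h $$ (r, s))"
    proof (cases "blk r = blk s")
      case False
      then have "eqv (h * (tv r s x * rmat D)) (h * rmat D)"
        using le l h by (intro eqv_absorb_root) auto
      from eqv_trans[OF eq this] show ?thesis using h by (intro bexI[OF _ h]) simp
    next
      case True
      then have t: "tv r s x \<in> block_diag" using tv_block_diag l ne by blast
      \<comment> \<open>The rook in a column of block \<open>m\<close> lies in a row of a later
        block, so multiplication by \<open>tv r s x\<close> changes \<open>h\<close> only in that
        later block.\<close>
      have "(h * tv r s x) $$ (u, v) = h $$ (u, v)" if "u < n" "v < n" "blk u \<le> m" for u v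
      proof -
        have "blk u \<noteq> blk r" using that l cd ab by (auto simp: doubleton_eq_iff)
        then have "h $$ (u, r) = 0" using block_diag_entry[OF h \<open>u < n\<close> l(2)] by blast
        then show ?thesis unfolding tv_mult_right[OF c l(2) that(1,2)] by simp
      qed
      moreover have "h * (tv r s x * rmat D) = h * tv r s x * rmat D" using c by (simp add: sq_assoc)
      ultimately show ?thesis using eq block_diag_mult[OF h t] by (intro bexI[of _ "h * tv r s x"]) simp_all
    qed
  qed
  show thesis
  proof (cases "(\<exists>r. (a, r) \<in> D) \<and> (\<exists>s. (b, s) \<in> D)")
    case False
    then show thesis using zero[of a b] zero[of b a] ab(3) by (auto simp: insert_commute)
  next
    case True
    then obtain r s where "(a, r) \<in> D" "(b, s) \<in> D" by blast
    then show thesis using both[of a b r s] both[of b a s r] ab(3)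
      by (cases "blk r \<le> blk s") (auto simp: insert_commute)
  qed
qed

text \<open>Row \<open>d\<close> is added to row \<open>c\<close> and column \<open>e\<close> to
  column \<open>f\<close>, so \<open>(d, e)\<close> is the pivot. If it is nonzero, it clears its
  row and its column; if it vanishes, \<open>(d, f)\<close> is nonzero by invertibility and clears
  \<open>(c, f)\<close>. The argument works for both orientations on both sides, so they may be
  prescribed independently.\<close>

lemma two_by_two_bruhat:
  assumes g: "g \<in> block_diag" and ab: "c < n" "d < n" "c \<noteq> d" "blk c = m" "blk d = m"
    and cd: "{c, d} = {e, f}" and two: "\<And>i. i < n \<Longrightarrow> blk i = m \<Longrightarrow> i = c \<or> i = d"
  obtains x y where "let h = tv c d y * (g * tv e f x) in
    (h $$ (d, e) = 0 \<or> h $$ (d, f) = 0) \<and> (h $$ (c, e) = 0 \<or> h $$ (c, f) = 0) \<and>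
    (h $$ (d, e) = 0 \<or> h $$ (c, e) = 0) \<and> (h $$ (d, f) = 0 \<or> h $$ (c, f) = 0)"
proof -
  have ef: "e < n" "f < n" "e \<noteq> f" using cd ab by (auto simp: doubleton_eq_iff)
  have gc: "g \<in> carrier_mat n n" using g by simp
  have E: "(tv c d y * (g * tv e f x)) $$ (u, v) = g $$ (u, v) + (if v = f then g $$ (u, e) * x else 0)
      + (if u = c then y * (g $$ (d, v) + (if v = f then g $$ (d, e) * x else 0)) else 0)"
    if uv: "u < n" "v < n" for x y u v
  proof -
    have "g * tv e f x \<in> carrier_mat n n" using gc by simp
    from tv_mult_left[OF this ab(2) uv] show ?thesis
      unfolding tv_mult_right[OF gc ef(1) uv] tv_mult_right[OF gc ef(1) ab(2) uv(2)] .
  qed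
  show thesis
  proof (cases "g $$ (d, e) = 0")
    case True
    obtain j where j: "j < n" "g $$ (d, j) \<noteq> 0" using par_row_nonzero[of g d] block_diag_par g ab by auto
    then have "blk j = m" using block_diag_entry[OF g ab(2)] ab by metis
    then have "j = f" using two[OF j(1)] cd j True by (auto simp: doubleton_eq_iff)
    then have nz: "g $$ (d, f) \<noteq> 0" using j by simp
    show thesis
      by (rule that[of "- g $$ (c, f) / g $$ (d, f)" 0])
        (use True nz ef ab in \<open>simp add: Let_def E del: index_mult_mat\<close>)
  next
    case False
    show thesis
      by (rule that[of "- g $$ (c, e) / g $$ (d, e)" "- g $$ (d, f) / g $$ (d, e)"])
        (use False ef ab in \<open>simp add: Let_def E del: index_mult_mat\<close>)
  qed
qed

end

subsection \<open>Reduction to a rook placement\<close>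

locale small_blocks = blocked +
  assumes small: "i < n \<Longrightarrow> j < n \<Longrightarrow> k < n \<Longrightarrow> blk i = blk j \<Longrightarrow> blk j = blk k \<Longrightarrow> i = j \<or> j = k \<or> i = k"
begin

lemma mono_below_extend:
  assumes g: "g \<in> block_diag" "mono_below g m" and h: "h \<in> block_diag"
    and below: "\<And>u v. u < n \<Longrightarrow> v < n \<Longrightarrow> blk u < m \<Longrightarrow> h $$ (u, v) = g $$ (u, v)"
    and row: "\<And>u v v'. u < n \<Longrightarrow> v < n \<Longrightarrow> v' < n \<Longrightarrow> blk u = m \<Longrightarrow> blk v = m \<Longrightarrow> blk v' = m \<Longrightarrow>
      v \<noteq> v' \<Longrightarrow> h $$ (u, v) = 0 \<or> h $$ (u, v') = 0"
    and col: "\<And>u u' v. u < n \<Longrightarrow> u' < n \<Longrightarrow> v < n \<Longrightarrow> blk u = m \<Longrightarrow> blk u' = m \<Longrightarrow> blk v = m \<Longrightarrow>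
      u \<noteq> u' \<Longrightarrow> h $$ (u, v) = 0 \<or> h $$ (u', v) = 0"
  shows "mono_below h (Suc m)"
  unfolding mono_below_def
proof (rule allI, rule impI, rule allI, rule impI, rule impI, rule impI, rule conjI; rule allI, rule impI, rule impI)
  fix i j i' assume a: "i < n" "j < n" "blk i < Suc m" "h $$ (i, j) \<noteq> 0" "i' < n" "h $$ (i', j) \<noteq> 0"
  have b: "blk i = blk j" "blk i' = blk j" using block_diag_entry[OF h] a by blast+
  show "i' = i"
  proof (cases "blk i < m")
    case True
    then have "g $$ (i, j) \<noteq> 0" "g $$ (i', j) \<noteq> 0" using a b below by simp_all
    then show ?thesis using g(2) True a unfolding mono_below_def by blast
  next
    case False
    then show ?thesis using col[of i i' j] a b by fastforce
  qed
next
  fix i j j' assume a: "i < n" "j < n" "blk i < Suc m" "h $$ (i, j) \<noteq> 0" "j' < n" "h $$ (i, j') \<noteq> 0"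
  have b: "blk i = blk j" "blk i = blk j'" using block_diag_entry[OF h] a by blast+
  show "j' = j"
  proof (cases "blk i < m")
    case True
    then have "g $$ (i, j) \<noteq> 0" "g $$ (i, j') \<noteq> 0" using a below by simp_all
    then show ?thesis using g(2) True a unfolding mono_below_def by blast
  next
    case False
    then show ?thesis using row[of i j j'] a b by fastforce
  qed
qed

text \<open>The two sides play different roles: the right transvection is inserted for free because
  it can be absorbed, the left one is pushed on to later blocks. Their orientations are imposed
  separately and need not match.\<close>

lemma mono_step:
  fixes g :: "'a::{field,finite} mat"
  assumes D: "rook D" and g: "g \<in> block_diag" "mono_below g m"
  shows "\<exists>h\<in>block_diag. eqv (g * rmat D) (h * rmat D) \<and> mono_below h (Suc m)"
proof (cases "\<exists>a b. a < n \<and> b < n \<and> a \<noteq> b \<and> blk a = m \<and> blk b = m")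
  case False
  then have "mono_below g (Suc m)" by (intro mono_below_extend[OF g g(1)]) blast+
  then show ?thesis using g by (intro bexI[of _ g]) (simp_all add: eqv_refl)
next
  case True
  then obtain a b where ab: "a < n" "b < n" "a \<noteq> b" "blk a = m" "blk b = m" by blast
  have gc: "g \<in> carrier_mat n n" using g by simp
  obtain e f where ef: "{e, f} = {a, b}" "e \<noteq> f"
    and absorb: "\<And>x. eqv (g * (tv e f x * rmat D)) (g * rmat D)"
    using absorb_orientation[OF D g ab] ab(3) by (metis insert_commute)
  obtain c d where cd: "{c, d} = {a, b}" "c \<noteq> d"
    and push: "\<And>(h :: 'a mat) (x :: 'a). h \<in> block_diag \<Longrightarrow> \<exists>h'\<in>block_diag.
       eqv (tv c d x * (h * rmat D)) (h' * rmat D) \<and>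
       (\<forall>r<n. \<forall>s<n. blk r \<le> m \<longrightarrow> h' $$ (r, s) = h $$ (r, s))"
    using push_orientation[OF D ab] by blast
  have cd': "c < n" "d < n" "blk c = m" "blk d = m" and ef': "e < n" "f < n" "blk e = m" "blk f = m"
    using cd ef ab by (auto simp: doubleton_eq_iff)
  have two: "i = c \<or> i = d" if "i < n" "blk i = m" for i
    using small[of i c d] that cd' cd by auto
  have cdef: "{c, d} = {e, f}" using cd ef by simp
  obtain x y where xy: "let h = tv c d y * (g * tv e f x) in
    (h $$ (d, e) = 0 \<or> h $$ (d, f) = 0) \<and> (h $$ (c, e) = 0 \<or> h $$ (c, f) = 0) \<and>
    (h $$ (d, e) = 0 \<or> h $$ (c, e) = 0) \<and> (h $$ (d, f) = 0 \<or> h $$ (c, f) = 0)"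
    using two_by_two_bruhat[OF g(1) cd'(1,2) cd(2) cd'(3,4) cdef two] by blast
  define k where "k = g * tv e f x"
  define h where "h = tv c d y * k"
  have hz: "h $$ (d, e) = 0 \<or> h $$ (d, f) = 0" "h $$ (c, e) = 0 \<or> h $$ (c, f) = 0"
    "h $$ (d, e) = 0 \<or> h $$ (c, e) = 0" "h $$ (d, f) = 0 \<or> h $$ (c, f) = 0"
    using xy unfolding h_def k_def Let_def by blast+
  have tcd: "tv c d y \<in> block_diag" and tef: "tv e f x \<in> block_diag"
    by (intro tv_block_diag; use cd' ef' cd(2) ef(2) in simp)+
  have kb: "k \<in> block_diag" and hb: "h \<in> block_diag"
    unfolding h_def k_def using tcd tef g block_diag_mult by blast+
  have kc: "k \<in> carrier_mat n n" and hc: "h \<in> carrier_mat n n" using kb hb by simp_all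
  \<comment> \<open>The matrix equivalent to \<open>g * rmat D\<close> is \<open>k * rmat D\<close>,
    not \<open>h * rmat D\<close>. The two differ by \<open>tv c d (- y)\<close> on the left, and
    this is the factor to be pushed away.\<close>
  have k_h: "k = tv c d (- y) * h"
    using tv_inverse[OF cd'(1,2) cd(2), of "- y"] kc unfolding h_def by (simp add: sq_assoc[symmetric])
  obtain h' where h': "h' \<in> block_diag" "eqv (tv c d (- y) * (h * rmat D)) (h' * rmat D)"
    "\<forall>r<n. \<forall>s<n. blk r \<le> m \<longrightarrow> h' $$ (r, s) = h $$ (r, s)"
    using push[OF hb, of "- y"] by blast
  have "eqv (g * rmat D) (k * rmat D)"
    using eqv_sym[OF absorb[of x]] gc unfolding k_def by (simp add: sq_assoc)
  moreover have "eqv (k * rmat D) (h' * rmat D)"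
    using h'(2) hc unfolding k_h by (simp add: sq_assoc)
  ultimately have "eqv (g * rmat D) (h' * rmat D)"
    using eqv_trans[of "g * rmat D" "k * rmat D" "h' * rmat D"] gc kc h'(1) by simp
  moreover have "mono_below h' (Suc m)"
  proof (rule mono_below_extend[OF g h'(1)])
    fix u v assume uv: "u < n" "v < n" "blk u < m"
    have "u \<noteq> c" using uv cd' by auto
    moreover have "g $$ (u, e) = 0" using block_diag_entry[OF g(1) uv(1) ef'(1)] uv ef' by fastforce
    ultimately have "h $$ (u, v) = g $$ (u, v)"
      unfolding h_def tv_mult_left[OF kc cd'(2) uv(1,2)]
      unfolding k_def tv_mult_right[OF gc ef'(1) uv(1,2)] by simp
    then show "h' $$ (u, v) = g $$ (u, v)" using h'(3) uv by simp
  next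
    fix u v v' assume a: "u < n" "v < n" "v' < n" "blk u = m" "blk v = m" "blk v' = m" "v \<noteq> v'"
    have "v \<in> {e, f}" "v' \<in> {e, f}" using two[OF a(2,5)] two[OF a(3,6)] cdef by blast+
    then have "v = e \<and> v' = f \<or> v = f \<and> v' = e" using a(7) by blast
    moreover have "u = c \<or> u = d" using two[OF a(1,4)] .
    ultimately have "h $$ (u, v) = 0 \<or> h $$ (u, v') = 0" using hz by blast
    then show "h' $$ (u, v) = 0 \<or> h' $$ (u, v') = 0" using h'(3) a by simp
  next
    fix u u' v assume a: "u < n" "u' < n" "v < n" "blk u = m" "blk u' = m" "blk v = m" "u \<noteq> u'"
    have "v \<in> {e, f}" using two[OF a(3,6)] cdef by blast
    then have "v = e \<or> v = f" by simp
    moreover have "u = c \<and> u' = d \<or> u = d \<and> u' = c"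
      using two[OF a(1,4)] two[OF a(2,5)] a(7) by blast
    ultimately have "h $$ (u, v) = 0 \<or> h $$ (u', v) = 0" using hz by blast
    then show "h' $$ (u, v) = 0 \<or> h' $$ (u', v) = 0" using h'(3) a by simp
  qed
  ultimately show ?thesis using h'(1) by blast
qed

lemma mono_reduce:
  fixes g :: "'a::{field,finite} mat"
  assumes D: "rook D" and g: "g \<in> block_diag"
  shows "\<exists>h\<in>block_diag. eqv (g * rmat D) (h * rmat D) \<and> mono_below h m"
proof (induction m)
  case 0
  then show ?case using g by (intro bexI[OF _ g]) (simp add: eqv_refl mono_below_def)
next
  case (Suc m)
  then obtain h where h: "h \<in> block_diag" "eqv (g * rmat D) (h * rmat D)" "mono_below h m" by blast
  obtain k where k: "k \<in> block_diag" "eqv (h * rmat D) (k * rmat D)" "mono_below k (Suc m)"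
    using mono_step[OF D h(1,3)] by blast
  have "eqv (g * rmat D) (k * rmat D)"
    using eqv_trans[OF h(2) k(2)] g h k by simp
  then show ?case using k by blast
qed

end

section \<open>Diagonal scaling, and splitting off a block diagonal factor\<close>

context blocked
begin

definition dmat :: "(nat \<Rightarrow> 'a::{field,finite}) \<Rightarrow> 'a mat" where
  "dmat t = mat n n (\<lambda>(i, j). if i = j then t i else 0)"

lemma dmat_carrier [simp]: "dmat t \<in> carrier_mat n n"
  by (simp add: dmat_def)

lemma dmat_mult_left:
  assumes "X \<in> carrier_mat n n" "i < n" "j < n" shows "(dmat t * X) $$ (i, j) = t i * X $$ (i, j)"
proof -
  have "(dmat t * X) $$ (i, j) = (\<Sum>l<n. if i = l then t i * X $$ (l, j) else 0)"
    unfolding mat_mult_entry[OF dmat_carrier assms]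
    using assms by (intro sum.cong) (simp_all add: dmat_def)
  then show ?thesis using assms by simp
qed

lemma dmat_mult_right:
  assumes "X \<in> carrier_mat n n" "i < n" "j < n" shows "(X * dmat t) $$ (i, j) = X $$ (i, j) * t j"
proof -
  have "(X * dmat t) $$ (i, j) = (\<Sum>l<n. if l = j then X $$ (i, l) * t j else 0)"
    unfolding mat_mult_entry[OF assms(1) dmat_carrier assms(2,3)]
    using assms by (intro sum.cong) (simp_all add: dmat_def)
  then show ?thesis using assms by simp
qed

lemma dmat_block_diag:
  assumes "\<And>i. t i \<noteq> 0" shows "dmat t \<in> block_diag"
proof -
  have *: "dmat s * dmat s' = 1\<^sub>m n" if "\<And>i. s i * s' i = 1" for s s' :: "nat \<Rightarrow> 'a"
  proof (rule sq_eqI)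
    fix i j assume "i < n" "j < n"
    then show "(dmat s * dmat s') $$ (i, j) = 1\<^sub>m n $$ (i, j)"
      unfolding dmat_mult_left[OF dmat_carrier \<open>i < n\<close> \<open>j < n\<close>] using that by (simp add: dmat_def)
  qed simp_all
  have "dmat t * dmat (\<lambda>i. inverse (t i)) = 1\<^sub>m n" "dmat (\<lambda>i. inverse (t i)) * dmat t = 1\<^sub>m n"
    by (rule *, simp add: assms)+
  moreover have "dmat t \<in> upper" by (auto simp: upper_def dmat_def)
  ultimately have "dmat t \<in> par" unfolding par_def using dmat_carrier by blast
  then show ?thesis by (auto simp: block_diag_def dmat_def)
qed

definition low_monomial :: "'a::{field,finite} mat \<Rightarrow> bool" where
  "low_monomial X \<longleftrightarrow> X \<in> carrier_mat n n \<and> monomial X \<and>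
     (\<forall>i<n. \<forall>j<n. X $$ (i, j) \<noteq> 0 \<longrightarrow> blk j < blk i)"

definition shape :: "'a::{field,finite} mat \<Rightarrow> (nat \<times> nat) set" where
  "shape X = {(j, i). i < n \<and> j < n \<and> X $$ (i, j) \<noteq> 0}"

lemma low_monomialD:
  assumes "low_monomial X" "i < n" "j < n" "X $$ (i, j) \<noteq> 0"
  shows "blk j < blk i" "\<And>j'. j' < n \<Longrightarrow> X $$ (i, j') \<noteq> 0 \<Longrightarrow> j' = j"
    "\<And>i'. i' < n \<Longrightarrow> X $$ (i', j) \<noteq> 0 \<Longrightarrow> i' = i"
  using assms unfolding low_monomial_def monomial_def by auto

lemma rook_shape:
  assumes "low_monomial X" shows "rook (shape X)"
  unfolding rook_def shape_def using low_monomialD[OF assms] by blast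

text \<open>A nonzero entry \<open>(i, j)\<close> has \<open>j < i\<close> and is alone in its row,
  so the condition determines \<open>t i\<close> from the earlier value \<open>t j\<close>. It says
  that conjugation by the diagonal matrix of \<open>t\<close> replaces all nonzero entries by
  1.\<close>

lemma low_monomial_scaling:
  assumes X: "low_monomial X"
  shows "\<exists>t :: nat \<Rightarrow> 'a::{field,finite}. (\<forall>i. t i \<noteq> 0) \<and>
    (\<forall>i<m. \<forall>j<n. i < n \<longrightarrow> X $$ (i, j) \<noteq> 0 \<longrightarrow> t i * X $$ (i, j) = t j)"
proof (induction m)
  case 0
  show ?case by (rule exI[of _ "\<lambda>_. 1"]) simp
next
  case (Suc m)
  then obtain t :: "nat \<Rightarrow> 'a" where t: "\<forall>i. t i \<noteq> 0"
    "\<forall>i<m. \<forall>j<n. i < n \<longrightarrow> X $$ (i, j) \<noteq> 0 \<longrightarrow> t i * X $$ (i, j) = t j" by blast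
  show ?case
  proof (cases "\<exists>j<n. m < n \<and> X $$ (m, j) \<noteq> 0")
    case True
    then obtain j where j: "j < n" "m < n" "X $$ (m, j) \<noteq> 0" by blast
    define s where "s = t(m := t j / X $$ (m, j))"
    have below: "v < u" if "u < n" "v < n" "X $$ (u, v) \<noteq> 0" for u v
      using low_monomialD(1)[OF X that] blk_mono[of u v] that by (meson leD linorder_not_less)
    have "s u * X $$ (u, v) = s v" if "u < Suc m" "v < n" "u < n" "X $$ (u, v) \<noteq> 0" for u v
    proof (cases "u = m")
      case True
      then have "v = j" using low_monomialD(2)[OF X j(2,1,3) that(2)] that by simp
      then show ?thesis using True below[OF j(2,1,3)] j by (simp add: s_def)
    next
      case False
      then show ?thesis using t(2) that below[OF that(3,2,4)] by (simp add: s_def)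
    qed
    moreover have "\<forall>i. s i \<noteq> 0" using t(1) j by (simp add: s_def)
    ultimately show ?thesis by blast
  next
    case False
    then show ?thesis using t by (intro exI[of _ t]) (metis less_Suc_eq)
  qed
qed

lemma eqv_rmat_shape:
  assumes X: "low_monomial X" shows "eqv X (rmat (shape X))"
proof -
  obtain t :: "nat \<Rightarrow> 'a" where t: "\<forall>i. t i \<noteq> 0"
    "\<forall>i<n. \<forall>j<n. i < n \<longrightarrow> X $$ (i, j) \<noteq> 0 \<longrightarrow> t i * X $$ (i, j) = t j"
    using low_monomial_scaling[OF X, of n] by blast
  have Xc: "X \<in> carrier_mat n n" using X by (simp add: low_monomial_def)
  have "dmat t * X = rmat (shape X) * dmat t"
  proof (rule sq_eqI)
    fix i j assume ij: "i < n" "j < n"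
    show "(dmat t * X) $$ (i, j) = (rmat (shape X) * dmat t) $$ (i, j)"
      unfolding dmat_mult_left[OF Xc ij] dmat_mult_right[OF rmat_carrier ij]
      using ij t(2) by (simp add: rmat_entry shape_def)
  qed (use Xc in simp_all)
  moreover have "dmat t \<in> par" using dmat_block_diag block_diag_par t(1) by blast
  ultimately show ?thesis unfolding eqv_def by (intro bexI[of _ "dmat t"]) simp_all
qed

lemma low_monomial_factor:
  assumes X: "low_monomial X"
  obtains s where "s \<in> block_diag" "X = s * rmat (shape X)"
proof
  \<comment> \<open>Row \<open>i\<close> is scaled by its only nonzero entry; the default 1 in zero
    rows keeps \<open>dmat t\<close> invertible.\<close>
  define t where "t i = (if \<exists>j<n. X $$ (i, j) \<noteq> 0 then X $$ (i, SOME j. j < n \<and> X $$ (i, j) \<noteq> 0) else 1)" for i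
  have t: "t i = X $$ (i, j)" if "i < n" "j < n" "X $$ (i, j) \<noteq> 0" for i j
  proof -
    have "(SOME j. j < n \<and> X $$ (i, j) \<noteq> 0) = j"
      by (rule some_equality) (use that low_monomialD(2)[OF X that] in blast)+
    moreover have "\<exists>j<n. X $$ (i, j) \<noteq> 0" using that by blast
    ultimately show ?thesis by (simp add: t_def)
  qed
  have "t i \<noteq> 0" for i
    unfolding t_def by (simp, metis (mono_tags, lifting) someI_ex)
  then show "dmat t \<in> block_diag" by (rule dmat_block_diag)
  have Xc: "X \<in> carrier_mat n n" using X by (simp add: low_monomial_def)
  show "X = dmat t * rmat (shape X)"
  proof (rule sq_eqI)
    fix i j assume ij: "i < n" "j < n"
    show "X $$ (i, j) = (dmat t * rmat (shape X)) $$ (i, j)"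
      unfolding dmat_mult_left[OF rmat_carrier ij] using ij t by (simp add: rmat_entry shape_def)
  qed (use Xc in simp_all)
qed

text \<open>The pair \<open>dg q * dg p * p^-1\<close> and \<open>q\<close> is admissible, as both
  have diagonal part \<open>dg q\<close>. Two independent factors in P are thereby traded for one
  block diagonal factor.\<close>

lemma eqv_sandwich:
  assumes "p \<in> par" "q \<in> par" "Z \<in> carrier_mat n n"
  shows "eqv (p * Z * q) (dg q * dg p * Z)"
proof -
  obtain p' where p': "p' \<in> par" "p * p' = 1\<^sub>m n" "p' * p = 1\<^sub>m n" using par_inverse assms by blast
  have d: "dg p \<in> par" "dg q \<in> par" using dg_in_block_diag block_diag_par assms by blast+
  have dd: "dg (dg p) = dg p" "dg (dg q) = dg q" using dg_block_diag dg_in_block_diag assms by blast+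
  have c: "p \<in> carrier_mat n n" "q \<in> carrier_mat n n" "p' \<in> carrier_mat n n" using assms p' by auto
  have "dg p * dg p' = 1\<^sub>m n" using p' assms by (metis dg_mult dg_one par_upper)
  then have "dg (dg q * (dg p * p')) = dg q"
    using d p' dd by (simp add: dg_mult upper_mult par_upper)
  moreover have "dg q * (dg p * p') \<in> par" using d p' par_mult by blast
  moreover have "dg q * (dg p * p') * (p * Z * q) = dg q * dg p * Z * q"
    using c assms(3) p' by (simp add: sq_assoc cancel_inverse)
  ultimately show ?thesis unfolding eqv_def using assms by (metis low_eq_refl)
qed

lemma eqv_block_diag_rmat:
  fixes X :: "'a::{field,finite} mat"
  assumes X: "X \<in> carrier_mat n n"
  obtains g D where "g \<in> block_diag" "rook D" "eqv X (g * rmat D)"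
proof -
  obtain p q where pq: "p \<in> par" "q \<in> par" "monomial (p * X * q)" using par_monomial_form[OF X] by blast
  obtain p' where p': "p' \<in> par" "p * p' = 1\<^sub>m n" "p' * p = 1\<^sub>m n" using par_inverse pq by blast
  obtain q' where q': "q' \<in> par" "q * q' = 1\<^sub>m n" "q' * q = 1\<^sub>m n" using par_inverse pq by blast
  define Y where "Y = p * X * q"
  have c: "p \<in> carrier_mat n n" "q \<in> carrier_mat n n" "p' \<in> carrier_mat n n" "q' \<in> carrier_mat n n"
    using pq p' q' by auto
  have Yc: "Y \<in> carrier_mat n n" using c X by (simp add: Y_def)
  \<comment> \<open>Erasing the entries on and above the block diagonal is invisible to
    \<open>low_eq\<close>, and it confines the rooks to the positions of roots.\<close>
  define Z where "Z = mat n n (\<lambda>(i, j). if blk j < blk i then Y $$ (i, j) else 0)"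
  have Zc: "Z \<in> carrier_mat n n" by (simp add: Z_def)
  have "monomial Y" using pq by (simp add: Y_def)
  then have Z: "low_monomial Z"
    using Yc Zc unfolding low_monomial_def monomial_def by (simp add: Z_def)
  obtain s where s: "s \<in> block_diag" "Z = s * rmat (shape Z)" using low_monomial_factor[OF Z] by blast
  have "X = p' * Y * q'" using c p' q' X by (simp add: Y_def sq_assoc cancel_inverse)
  moreover have "low_eq (p' * Y * q') (p' * Z * q')"
    using c p' q' Yc Zc
    by (intro low_eq_mult_left low_eq_mult_right par_upper) (simp_all add: low_eq_def Z_def)
  ultimately have "eqv X (p' * Z * q')" using X c Zc by (simp add: eqv_low_eq)
  moreover have "eqv (p' * Z * q') (dg q' * dg p' * Z)" using eqv_sandwich p' q' Zc by blast
  ultimately have "eqv X (dg q' * dg p' * Z)"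
    using eqv_trans[of X "p' * Z * q'" "dg q' * dg p' * Z"] X c Zc by simp
  moreover have "dg q' * dg p' * Z = dg q' * dg p' * s * rmat (shape Z)"
    using c s(1) by (subst s(2)) (simp add: sq_assoc[of _ _ "rmat (shape Z)"])
  moreover have "dg q' * dg p' * s \<in> block_diag"
    using dg_in_block_diag p' q' s block_diag_mult by blast
  ultimately show thesis using that rook_shape[OF Z] by metis
qed

lemma low_monomial_mult:
  assumes g: "g \<in> block_diag" and mono: "\<And>m. mono_below g m" and D: "rook D"
  shows "low_monomial (g * rmat D)"
proof -
  have gc: "g \<in> carrier_mat n n" using g by simp
  have nz: "\<exists>l<n. g $$ (i, l) \<noteq> 0 \<and> (j, l) \<in> D"
    if ij: "i < n" "j < n" "(g * rmat D) $$ (i, j) \<noteq> 0" for i j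
  proof -
    have "(\<Sum>l<n. g $$ (i, l) * rmat D $$ (l, j)) \<noteq> 0"
      using ij(3) unfolding mat_mult_entry[OF gc rmat_carrier ij(1,2)] .
    then obtain l where "l \<in> {..<n}" "g $$ (i, l) * rmat D $$ (l, j) \<noteq> 0"
      by (rule sum.not_neutral_contains_not_neutral)
    then show ?thesis using ij(2) by (intro exI[of _ l]) (simp add: rmat_entry split: if_splits)
  qed
  have "blk j < blk i \<and> (\<forall>i'<n. (g * rmat D) $$ (i', j) \<noteq> 0 \<longrightarrow> i' = i) \<and>
      (\<forall>j'<n. (g * rmat D) $$ (i, j') \<noteq> 0 \<longrightarrow> j' = j)"
    if ij: "i < n" "j < n" "(g * rmat D) $$ (i, j) \<noteq> 0" for i j
  proof -
    obtain l where l: "l < n" "g $$ (i, l) \<noteq> 0" "(j, l) \<in> D" using nz[OF ij] by blast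
    have u: "\<And>i'. i' < n \<Longrightarrow> g $$ (i', l) \<noteq> 0 \<Longrightarrow> i' = i" "\<And>l'. l' < n \<Longrightarrow> g $$ (i, l') \<noteq> 0 \<Longrightarrow> l' = l"
      using mono[of "Suc (blk i)"] ij(1) l unfolding mono_below_def by blast+
    have "blk j < blk i" using block_diag_entry[OF g ij(1) l(1,2)] rookD(3)[OF D l(3)] by simp
    moreover have "i' = i" if i': "i' < n" "(g * rmat D) $$ (i', j) \<noteq> 0" for i'
    proof -
      obtain l' where "l' < n" "g $$ (i', l') \<noteq> 0" "(j, l') \<in> D" using nz[OF i'(1) ij(2) i'(2)] by blast
      then have "g $$ (i', l) \<noteq> 0" using rookD(4)[OF D l(3), of l'] by simp
      then show ?thesis using u(1) i'(1) by blast
    qed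
    moreover have "j' = j" if j': "j' < n" "(g * rmat D) $$ (i, j') \<noteq> 0" for j'
    proof -
      obtain l' where "l' < n" "g $$ (i, l') \<noteq> 0" "(j', l') \<in> D" using nz[OF ij(1) j'] by blast
      moreover from this have "l' = l" using u(2) by blast
      ultimately show ?thesis using rookD(5)[OF D l(3), of j'] by simp
    qed
    ultimately show ?thesis by blast
  qed
  moreover have c: "g * rmat D \<in> carrier_mat n n" using gc by simp
  ultimately show ?thesis unfolding low_monomial_def monomial_def carrier_matD[OF c] by blast
qed

end

context small_blocks
begin

lemma rook_representative:
  fixes X :: "'a::{field,finite} mat"
  assumes X: "X \<in> carrier_mat n n"
  obtains D where "rook D" "eqv X (rmat D)"
proof -
  obtain g D where g: "g \<in> block_diag" "rook D" "eqv X (g * rmat D)" using eqv_block_diag_rmat[OF X] by blast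
  \<comment> \<open>A bound above all block numbers, so that \<open>mono_below h m\<close> concerns
    every row.\<close>
  define m where "m = Suc (Max (blk ` {..<n}))"
  have m: "blk i < m" if "i < n" for i using that by (auto simp: m_def less_Suc_eq_le intro!: Max_ge)
  obtain h where h: "h \<in> block_diag" "eqv (g * rmat D) (h * rmat D)" "mono_below h m"
    using mono_reduce[OF g(2,1)] by blast
  have "mono_below h k" for k using h(3) m unfolding mono_below_def by blast
  then have lm: "low_monomial (h * rmat D)" using low_monomial_mult h(1) g(2) by blast
  have c: "g \<in> carrier_mat n n" "h \<in> carrier_mat n n" using g h by simp_all
  have "eqv X (h * rmat D)" using eqv_trans[OF g(3) h(2)] X c by simp
  then have "eqv X (rmat (shape (h * rmat D)))" using eqv_trans[OF _ eqv_rmat_shape[OF lm]] X c by simp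
  then show thesis using that rook_shape[OF lm] by blast
qed

end

subsection \<open>Equivalent rook placements are conjugate\<close>

text \<open>A nonzero determinant has a nonzero term in its Leibniz expansion. The inverse of that
  permutation is returned, since the entries are wanted at \<open>(w i, i)\<close>.\<close>

lemma invertible_transversal:
  fixes A :: "'a::field mat"
  assumes "A \<in> carrier_mat n n" "B \<in> carrier_mat n n" "A * B = 1\<^sub>m n"
  obtains w where "w permutes {..<n}" "\<And>i. i < n \<Longrightarrow> A $$ (w i, i) \<noteq> 0"
proof -
  have "det A * det B = 1" using det_mult[OF assms(1,2)] assms(3) by simp
  then have "det A \<noteq> 0" by auto
  then have "(\<Sum>p\<in>{p. p permutes {0..<n}}. signof p * (\<Prod>i = 0..<n. A $$ (i, p i))) \<noteq> 0"
    using det_def'[OF assms(1)] by simp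
  then obtain p where p: "p \<in> {p. p permutes {0..<n}}" "signof p * (\<Prod>i = 0..<n. A $$ (i, p i)) \<noteq> 0"
    by (rule sum.not_neutral_contains_not_neutral)
  have perm: "p permutes {..<n}" using p(1) by (simp add: atLeast0LessThan)
  have nz: "A $$ (i, p i) \<noteq> 0" if "i < n" for i
    using p(2) that by (auto simp: prod_zero_iff)
  have "A $$ (inv_into UNIV p i, i) \<noteq> 0" if "i < n" for i
  proof -
    have "inv_into UNIV p i < n" using permutes_in_image[OF permutes_inv[OF perm], of i] that by simp
    from nz[OF this] show ?thesis by (simp add: permutes_inverses(1)[OF perm])
  qed
  then show thesis using that permutes_inv[OF perm] by blast
qed

lemma permuted_sum_le_imp_eq:
  fixes f g :: "nat \<Rightarrow> nat"
  assumes w: "w permutes {..<n}" and le: "\<And>i. i < n \<Longrightarrow> g (w i) \<le> f i"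
    and sum: "(\<Sum>i<n. f i) \<le> (\<Sum>i<n. g i)" and "i < n"
  shows "g (w i) = f i"
proof (rule ccontr)
  assume "g (w i) \<noteq> f i"
  then have "g (w i) < f i" using le \<open>i < n\<close> by (simp add: le_neq_implies_less)
  then have "(\<Sum>i<n. g (w i)) < (\<Sum>i<n. f i)"
    using le \<open>i < n\<close> by (intro sum_strict_mono_ex1) auto
  moreover have "(\<Sum>i<n. g (w i)) = (\<Sum>i<n. g i)"
    using sum.permute[OF w, of g] by (simp add: comp_def)
  ultimately show False using sum by simp
qed

section \<open>Transversals and heights of rooks\<close>

context blocked
begin

text \<open>As \<open>w\<close> preserves blocks, its entries lie in the diagonal blocks, where
  \<open>p\<close> agrees with every \<open>q\<close> such that \<open>dg p = dg q\<close>.\<close>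

definition transversal :: "'a::{field,finite} mat \<Rightarrow> (nat \<Rightarrow> nat) \<Rightarrow> bool" where
  "transversal p w \<longleftrightarrow> w permutes {..<n} \<and> (\<forall>i<n. blk (w i) = blk i \<and> p $$ (w i, i) \<noteq> 0)"

lemma transversalD:
  assumes "transversal p w"
  shows "w permutes {..<n}" "w i < n \<longleftrightarrow> i < n" "i < n \<Longrightarrow> blk (w i) = blk i" "i < n \<Longrightarrow> p $$ (w i, i) \<noteq> 0"
  using assms permutes_in_image[of w "{..<n}" i] unfolding transversal_def by auto

lemma transversal_exists:
  assumes "p \<in> par" obtains w where "transversal p w"
proof -
  have "dg p \<in> block_diag" using dg_in_block_diag assms by blast
  then obtain p' where "p' \<in> block_diag" "dg p * p' = 1\<^sub>m n" using block_diag_inverse by blast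
  then obtain w where w: "w permutes {..<n}" "\<And>i. i < n \<Longrightarrow> dg p $$ (w i, i) \<noteq> 0"
    using invertible_transversal[of "dg p" n p'] by auto
  have "blk (w i) = blk i \<and> p $$ (w i, i) \<noteq> 0" if "i < n" for i
    using w(2)[OF that] that permutes_in_image[OF w(1), of i]
    by (simp add: dg_def split: if_splits)
  then show thesis using that w(1) unfolding transversal_def by blast
qed

lemma mult_rmat_entry:
  assumes "p \<in> carrier_mat n n" "rook D" "(i, l) \<in> D" "j < n"
  shows "(p * rmat D) $$ (j, i) = p $$ (j, l)"
proof -
  note l = rookD[OF assms(2,3)]
  have "(p * rmat D) $$ (j, i) = (\<Sum>k<n. if k = l then p $$ (j, k) else 0)"
    unfolding mat_mult_entry[OF assms(1) rmat_carrier assms(4) l(1)]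
    using l by (intro sum.cong) (simp_all add: rmat_entry)
  then show ?thesis using l by simp
qed

lemma mult_rmat_entry_0:
  assumes "p \<in> carrier_mat n n" "\<And>l. (i, l) \<notin> D" "j < n" "i < n"
  shows "(p * rmat D) $$ (j, i) = 0"
  unfolding mat_mult_entry[OF assms(1) rmat_carrier assms(3,4)]
  using assms by (intro sum.neutral) (simp add: rmat_entry)

lemma rmat_mult_entry:
  assumes "q \<in> carrier_mat n n" "rook D" "(l, j) \<in> D" "i < n"
  shows "(rmat D * q) $$ (j, i) = q $$ (l, i)"
proof -
  note l = rookD[OF assms(2,3)]
  have "(rmat D * q) $$ (j, i) = (\<Sum>k<n. if k = l then q $$ (k, i) else 0)"
    unfolding mat_mult_entry[OF rmat_carrier assms(1) l(2) assms(4)]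
    using l by (intro sum.cong) (simp_all add: rmat_entry)
  then show ?thesis using l by simp
qed

lemma rmat_mult_entry_0:
  assumes "q \<in> carrier_mat n n" "\<And>l. (l, j) \<notin> D" "j < n" "i < n"
  shows "(rmat D * q) $$ (j, i) = 0"
  unfolding mat_mult_entry[OF rmat_carrier assms(1,3,4)]
  using assms by (intro sum.neutral) (simp add: rmat_entry)

text \<open>A row without rook gets a height above that of all rows with a rook in the same block, a column without
  rook one below; the two monotonicity statements then also cover missing rooks.\<close>

definition row_height :: "(nat \<times> nat) set \<Rightarrow> nat \<Rightarrow> nat" where
  "row_height D j = (if \<exists>i. (i, j) \<in> D then blk (THE i. (i, j) \<in> D) else Suc (blk j))"

definition col_height :: "(nat \<times> nat) set \<Rightarrow> nat \<Rightarrow> nat" where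
  "col_height D i = (if \<exists>j. (i, j) \<in> D then blk (THE j. (i, j) \<in> D) else 0)"

lemma row_height: "rook D \<Longrightarrow> (i, j) \<in> D \<Longrightarrow> row_height D j = blk i"
  unfolding row_height_def by (metis rookD(5) the_equality)

lemma row_height_empty: "(\<And>i. (i, j) \<notin> D) \<Longrightarrow> row_height D j = Suc (blk j)"
  by (simp add: row_height_def)

lemma col_height: "rook D \<Longrightarrow> (i, j) \<in> D \<Longrightarrow> col_height D i = blk j"
  unfolding col_height_def by (metis rookD(4) the_equality)

lemma col_height_empty: "(\<And>j. (i, j) \<notin> D) \<Longrightarrow> col_height D i = 0"
  by (simp add: col_height_def)

end

locale rook_equivalence = blocked +
  fixes D D' :: "(nat \<times> nat) set" and p q :: "'a::{field,finite} mat"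
  assumes rooks: "rook D" "rook D'" and par: "p \<in> par" "q \<in> par" and dgs: "dg p = dg q"
    and low: "low_eq (p * rmat D) (rmat D' * q)"
begin

lemma same_block_entry:
  assumes "i < n" "j < n" "blk i = blk j" shows "q $$ (i, j) = p $$ (i, j)"
proof -
  have "dg q $$ (i, j) = dg p $$ (i, j)" by (simp only: dgs)
  then show ?thesis using assms by (simp add: dg_def)
qed

lemma entry_eq:
  assumes "j < n" "i < n" "blk i < blk j" shows "(p * rmat D) $$ (j, i) = (rmat D' * q) $$ (j, i)"
  using low assms unfolding low_eq_def by blast

text \<open>Compare position \<open>(j', i)\<close> of \<open>p * rmat D\<close> and
  \<open>rmat D' * q\<close>: each side reduces to a single term. Nonzero entries of
  \<open>q\<close> on columns of rooks thus become nonzero entries of \<open>p\<close> on rows of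
  rooks.\<close>

lemma entry_swap:
  assumes "(i, j) \<in> D" "(i', j') \<in> D'" "blk j = blk j'"
  shows "p $$ (j', j) = q $$ (i', i)"
proof -
  note l = rookD[OF rooks(1) assms(1)] rookD[OF rooks(2) assms(2)]
  show ?thesis
    using entry_eq[OF l(7) l(1)] l assms mult_rmat_entry[OF par_carrier[OF par(1)] rooks(1) assms(1) l(7)]
      rmat_mult_entry[OF par_carrier[OF par(2)] rooks(2) assms(2) l(1)] by simp
qed

text \<open>At position \<open>(w j, i)\<close> the left product is \<open>p $$ (w j, j)\<close>,
  which is nonzero. So row \<open>w j\<close> of \<open>rmat D'\<close> has a rook, in a column
  \<open>i'\<close> with \<open>q $$ (i', i)\<close> nonzero, and \<open>q\<close> is block upper
  triangular.\<close>

lemma row_image: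
  assumes w: "transversal p w" and ij: "(i, j) \<in> D"
  obtains i' where "(i', w j) \<in> D'" "blk i' \<le> blk i"
proof -
  note l = rookD[OF rooks(1) ij]
  have wj: "w j < n" "blk (w j) = blk j" "p $$ (w j, j) \<noteq> 0" using transversalD[OF w] l by simp_all
  have nz: "(rmat D' * q) $$ (w j, i) \<noteq> 0"
    using entry_eq[OF wj(1) l(1)] wj l mult_rmat_entry[OF par_carrier[OF par(1)] rooks(1) ij wj(1)] by simp
  then obtain i' where i': "(i', w j) \<in> D'"
    using rmat_mult_entry_0[OF par_carrier[OF par(2)], of "w j" D' i] wj l by blast
  then have "q $$ (i', i) \<noteq> 0"
    using nz rmat_mult_entry[OF par_carrier[OF par(2)] rooks(2) i' l(1)] by simp
  then have "blk i' \<le> blk i"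
    using par_upper[OF par(2)] l rookD(1)[OF rooks(2) i'] unfolding upper_def by (simp, meson linorder_not_less)
  then show thesis using that i' by blast
qed

text \<open>For columns the comparison runs backwards, from \<open>D'\<close> to \<open>D\<close>,
  starting from the nonzero entry \<open>q $$ (w i, i)\<close> of the right product. The heights
  still do not increase from \<open>D\<close> to \<open>D'\<close>.\<close>

lemma col_image:
  assumes w: "transversal p w" and ij: "(w i, j) \<in> D'" and "i < n"
  obtains j' where "(i, j') \<in> D" "blk j \<le> blk j'"
proof -
  note l = rookD[OF rooks(2) ij]
  have wi: "blk (w i) = blk i" "p $$ (w i, i) \<noteq> 0" using transversalD[OF w] \<open>i < n\<close> by simp_all
  have q: "q $$ (w i, i) \<noteq> 0" using same_block_entry[OF l(1) \<open>i < n\<close> wi(1)] wi by simp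
  have nz: "(p * rmat D) $$ (j, i) \<noteq> 0"
    using entry_eq[OF l(2) \<open>i < n\<close>] wi l q
      rmat_mult_entry[OF par_carrier[OF par(2)] rooks(2) ij \<open>i < n\<close>] by simp
  then obtain j' where j': "(i, j') \<in> D"
    using mult_rmat_entry_0[OF par_carrier[OF par(1)], of i D j] \<open>i < n\<close> l by blast
  then have "p $$ (j, j') \<noteq> 0"
    using nz mult_rmat_entry[OF par_carrier[OF par(1)] rooks(1) j' l(2)] by simp
  then have "blk j \<le> blk j'"
    using par_upper[OF par(1)] l rookD(2)[OF rooks(1) j'] unfolding upper_def by (simp, meson linorder_not_less)
  then show thesis using that j' by blast
qed

lemma row_height_le:
  assumes w: "transversal p w" and "j < n"
  shows "row_height D' (w j) \<le> row_height D j"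
proof (cases "\<exists>i. (i, j) \<in> D")
  case True
  then obtain i where ij: "(i, j) \<in> D" by blast
  obtain i' where "(i', w j) \<in> D'" "blk i' \<le> blk i" using row_image[OF w ij] by blast
  then show ?thesis using row_height[OF rooks(1) ij] row_height[OF rooks(2)] by simp
next
  case False
  then have e: "row_height D j = Suc (blk j)" by (intro row_height_empty) blast
  have b: "blk (w j) = blk j" using transversalD[OF w] \<open>j < n\<close> by simp
  show ?thesis
  proof (cases "\<exists>i. (i, w j) \<in> D'")
    case True
    then obtain i where "(i, w j) \<in> D'" by blast
    then show ?thesis using row_height[OF rooks(2), of i "w j"] rookD(3)[OF rooks(2), of i "w j"] e b by simp
  next
    case False
    then have "row_height D' (w j) = Suc (blk (w j))" by (intro row_height_empty) blast
    then show ?thesis using e b by simp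
  qed
qed

lemma col_height_le:
  assumes w: "transversal p w" and "i < n"
  shows "col_height D' (w i) \<le> col_height D i"
proof (cases "\<exists>j. (w i, j) \<in> D'")
  case True
  then obtain j where ij: "(w i, j) \<in> D'" by blast
  obtain j' where "(i, j') \<in> D" "blk j \<le> blk j'" using col_image[OF w ij \<open>i < n\<close>] by blast
  then show ?thesis using col_height[OF rooks(2) ij] col_height[OF rooks(1)] by simp
qed (simp add: col_height_empty)

lemma height_sums_le:
  "(\<Sum>j<n. row_height D' j) \<le> (\<Sum>j<n. row_height D j)"
  "(\<Sum>j<n. col_height D' j) \<le> (\<Sum>j<n. col_height D j)"
proof -
  obtain w where w: "transversal p w" using transversal_exists par by blast
  have perm: "(\<Sum>j<n. f (w j)) = (\<Sum>j<n. f j)" for f :: "nat \<Rightarrow> nat"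
    using sum.permute[OF transversalD(1)[OF w], of f] by (simp add: comp_def)
  show "(\<Sum>j<n. row_height D' j) \<le> (\<Sum>j<n. row_height D j)"
    using sum_mono[of "{..<n}" "\<lambda>j. row_height D' (w j)" "row_height D"] row_height_le[OF w] perm by simp
  show "(\<Sum>j<n. col_height D' j) \<le> (\<Sum>j<n. col_height D j)"
    using sum_mono[of "{..<n}" "\<lambda>j. col_height D' (w j)" "col_height D"] col_height_le[OF w] perm by simp
qed

end

text \<open>The two assumptions reverse \<open>height_sums_le\<close> and come from an equivalence
  in the other direction. They leave no room for a strict inequality in any row or column.\<close>

locale small_rook_equivalence = rook_equivalence + small_blocks +
  assumes row_sums: "(\<Sum>j<n. row_height D j) \<le> (\<Sum>j<n. row_height D' j)"
    and col_sums: "(\<Sum>j<n. col_height D j) \<le> (\<Sum>j<n. col_height D' j)"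
begin

lemma row_height_eq: "transversal p w \<Longrightarrow> j < n \<Longrightarrow> row_height D' (w j) = row_height D j"
  by (rule permuted_sum_le_imp_eq[OF transversalD(1) row_height_le row_sums])

lemma col_height_eq: "transversal p w \<Longrightarrow> j < n \<Longrightarrow> col_height D' (w j) = col_height D j"
  by (rule permuted_sum_le_imp_eq[OF transversalD(1) col_height_le col_sums])

lemma row_image_eq:
  assumes "transversal p w" "(i, j) \<in> D"
  obtains i' where "(i', w j) \<in> D'" "blk i' = blk i"
proof -
  obtain i' where i': "(i', w j) \<in> D'" using row_image[OF assms] by blast
  have "blk i' = blk i"
    using row_height_eq[OF assms(1) rookD(2)[OF rooks(1) assms(2)]]
    by (simp add: row_height[OF rooks(1) assms(2)] row_height[OF rooks(2) i'])
  then show thesis using that i' by blast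
qed

lemma row_preimage:
  assumes "transversal p w" "(i', w j) \<in> D'" "j < n"
  obtains i where "(i, j) \<in> D" "blk i = blk i'"
proof -
  have h: "row_height D j = blk i'" using row_height_eq[OF assms(1,3)] row_height[OF rooks(2) assms(2)] by simp
  have "blk i' < blk j" using rookD(3)[OF rooks(2) assms(2)] transversalD(3)[OF assms(1,3)] by simp
  \<comment> \<open>An empty row would have height \<open>Suc (blk j)\<close>, more than the height
    found here.\<close>
  then obtain i where "(i, j) \<in> D" using h row_height_empty[of j D] by fastforce
  then show thesis using that h row_height[OF rooks(1)] by metis
qed

lemma col_image_eq:
  assumes w: "transversal p w" and ij: "(i, j) \<in> D"
  obtains j' where "(w i, j') \<in> D'" "blk j' = blk j"
proof -
  have h: "col_height D' (w i) = blk j"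
    using col_height_eq[OF w rookD(1)[OF rooks(1) ij]] col_height[OF rooks(1) ij] by simp
  \<comment> \<open>Height 0 marks an empty column: the row of a rook is never in block 0, since its
    column lies in an earlier block.\<close>
  then have "col_height D' (w i) > 0" using rookD(3)[OF rooks(1) ij] by simp
  then obtain j' where "(w i, j') \<in> D'" using col_height_empty[of "w i" D'] by fastforce
  then show thesis using that h col_height[OF rooks(2)] by metis
qed

text \<open>The rooks are matched one row block at a time. Changing \<open>w\<close> on block
  \<open>m\<close> affects rooks with a row in that block and rooks with a column in it; the latter
  have their rows in later blocks, so increasing \<open>m\<close> never undoes earlier work.\<close>

lemma conjugating_transversal:
  "\<exists>w. transversal p w \<and> (\<forall>i j. (i, j) \<in> D \<longrightarrow> blk j < m \<longrightarrow> (w i, w j) \<in> D')"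
proof (induction m)
  case 0
  then show ?case using transversal_exists par by blast
next
  case (Suc m)
  then obtain w where w: "transversal p w"
    and below: "\<And>i j. (i, j) \<in> D \<Longrightarrow> blk j < m \<Longrightarrow> (w i, w j) \<in> D'" by blast
  note wD = transversalD[OF w]
  have inj: "w x = w y \<longleftrightarrow> x = y" for x y using permutes_inj[OF wD(1)] by (rule inj_eq)
  show ?case
  proof (cases "\<exists>i1 j1 i2 j2. (i1, j1) \<in> D \<and> (i2, j2) \<in> D \<and> j1 \<noteq> j2 \<and> blk j1 = m \<and> blk j2 = m
      \<and> blk i1 = blk i2")
    case False
    have "(w i, w j) \<in> D'" if ij: "(i, j) \<in> D" "blk j < Suc m" for i j
    proof (cases "blk j < m")
      case True
      then show ?thesis using below ij by blast
    next
      case nm: False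
      note l = rookD[OF rooks(1) ij(1)]
      \<comment> \<open>No second rook of \<open>D\<close> has its row in block \<open>m\<close> and
        its column in the block of \<open>i\<close>. The rook of \<open>D'\<close> in column
        \<open>w i\<close> is traced back along its row to a rook of \<open>D\<close> in this pair
        of blocks, so its row is \<open>w j\<close>.\<close>
      obtain j' where j': "(w i, j') \<in> D'" "blk j' = blk j" using col_image_eq[OF w ij(1)] by blast
      define j2 where "j2 = inv_into UNIV w j'"
      have wj2: "w j2 = j'" unfolding j2_def using permutes_inverses(1)[OF wD(1)] by simp
      have "j' < n" using rookD(2)[OF rooks(2) j'(1)] .
      then have j2n: "j2 < n" using wD(2)[of j2] wj2 by simp
      then have b2: "blk j2 = m" using wD(3)[OF j2n] wj2 j'(2) nm ij(2) by simp
      obtain i2 where i2: "(i2, j2) \<in> D" "blk i2 = blk (w i)"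
        using row_preimage[OF w, of "w i" j2] j'(1) wj2 j2n by blast
      have "blk i2 = blk i" using i2(2) wD(3)[OF l(1)] by simp
      then have "j2 = j" using False ij i2(1) b2 nm by (metis less_antisym)
      then show ?thesis using j'(1) wj2 by simp
    qed
    then show ?thesis using w by blast
  next
    case True
    then obtain i1 j1 i2 j2 where D12: "(i1, j1) \<in> D" "(i2, j2) \<in> D" and ne: "j1 \<noteq> j2"
      and bj: "blk j1 = m" "blk j2 = m" and bi: "blk i1 = blk i2" by blast
    note l1 = rookD[OF rooks(1) D12(1)] and l2 = rookD[OF rooks(1) D12(2)]
    have nei: "i1 \<noteq> i2" using l1(4)[of j2] D12(2) ne by auto
    have only: "j = j1 \<and> i = i1 \<or> j = j2 \<and> i = i2" if "(i, j) \<in> D" "blk j = m" for i j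
    proof -
      note l = rookD[OF rooks(1) that(1)]
      have "j = j1 \<or> j = j2" using small[of j j1 j2] l(2) l1(2) l2(2) that(2) bj ne by auto
      then show ?thesis using that(1) l1(5) l2(5) by blast
    qed
    obtain k1 where k1: "(k1, w j1) \<in> D'" "blk k1 = blk i1" using row_image_eq[OF w D12(1)] by blast
    obtain k2 where k2: "(k2, w j2) \<in> D'" "blk k2 = blk i2" using row_image_eq[OF w D12(2)] by blast
    note m1 = rookD[OF rooks(2) k1(1)] and m2 = rookD[OF rooks(2) k2(1)]
    have k12: "k1 \<noteq> k2" using m1(4)[of "w j2"] k2(1) ne inj by auto
    have bw: "blk (w i1) = blk i1" "blk (w i2) = blk i2" and wn: "w i1 < n" "w i2 < n"
      using wD(2,3) l1(1) l2(1) by simp_all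
    have wne: "w i1 \<noteq> w i2" using inj nei by simp
    \<comment> \<open>\<open>w i1\<close>, \<open>k1\<close> and \<open>k2\<close> share a block of
      at most two elements, and \<open>k1\<close>, \<open>k2\<close> are distinct.\<close>
    have "w i1 = k1 \<or> w i1 = k2" using small[of "w i1" k1 k2] wn m1(1) m2(1) bw k1 k2 bi k12 by auto
    moreover have "w i2 = k1 \<or> w i2 = k2" using small[of "w i2" k1 k2] wn m1(1) m2(1) bw k1 k2 bi k12 by auto
    ultimately consider (straight) "w i1 = k1" "w i2 = k2" | (crossed) "w i1 = k2" "w i2 = k1"
      using wne by metis
    then show ?thesis
    proof cases
      case straight
      have "(w i, w j) \<in> D'" if ij: "(i, j) \<in> D" "blk j < Suc m" for i j
      proof (cases "blk j < m")
        case True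
        then show ?thesis using below ij by blast
      next
        case False
        then have "j = j1 \<and> i = i1 \<or> j = j2 \<and> i = i2" using only ij by simp
        then show ?thesis using straight k1(1) k2(1) by auto
      qed
      then show ?thesis using w by blast
    next
      case crossed
      \<comment> \<open>Swapping the rows rather than the columns leaves \<open>w\<close> unchanged
        before block \<open>m\<close>, hence on the columns of all rooks considered so far.\<close>
      define v where "v = w \<circ> transpose j1 j2"
      have v: "v j1 = w j2" "v j2 = w j1" and v_other: "\<And>j. j \<noteq> j1 \<Longrightarrow> j \<noteq> j2 \<Longrightarrow> v j = w j"
        by (simp_all add: v_def transpose_apply_other)
      have v_below: "v j = w j" if "blk j < m" for j using v_other[of j] that bj by (cases "j = j1"; cases "j = j2") simp_all
      have "v permutes {..<n}" unfolding v_def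
        by (rule permutes_compose[OF permutes_swap_id wD(1)]) (use l1 l2 in simp_all)
      moreover have "blk (v i) = blk i \<and> p $$ (v i, i) \<noteq> 0" if "i < n" for i
      proof -
        have "blk (w j1) = m" "blk (w j2) = m" using wD(3) l1(2) l2(2) bj by simp_all
        \<comment> \<open>The crossing itself makes the swap admissible: the entries of
          \<open>p\<close> used by \<open>v\<close> equal entries of \<open>q\<close> at
          \<open>(w i1, i1)\<close> and \<open>(w i2, i2)\<close>, which are nonzero because
          \<open>w\<close> is a transversal and the diagonal blocks agree.\<close>
        moreover have "p $$ (w j2, j1) = q $$ (w i1, i1)"
          using entry_swap[OF D12(1) k2(1)] calculation bj crossed by simp
        moreover have "p $$ (w j1, j2) = q $$ (w i2, i2)"
          using entry_swap[OF D12(2) k1(1)] calculation bj crossed by simp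
        moreover have "q $$ (w i1, i1) \<noteq> 0" "q $$ (w i2, i2) \<noteq> 0"
          using same_block_entry[OF wn(1) l1(1) bw(1)] same_block_entry[OF wn(2) l2(1) bw(2)]
            wD(4)[OF l1(1)] wD(4)[OF l2(1)] by simp_all
        ultimately show ?thesis
          using v v_other[of i] wD(3,4)[OF that] bj by (cases "i = j1"; cases "i = j2") simp_all
      qed
      ultimately have tv: "transversal p v" unfolding transversal_def by blast
      have "(v i, v j) \<in> D'" if ij: "(i, j) \<in> D" "blk j < Suc m" for i j
      proof -
        have bl: "blk i < blk j" using rookD(3)[OF rooks(1) ij(1)] .
        then have vi: "v i = w i" using v_below ij(2) by simp
        show ?thesis
        proof (cases "blk j < m")
          case True
          then show ?thesis using below[OF ij(1)] v_below vi by simp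
        next
          case False
          then have "j = j1 \<and> i = i1 \<or> j = j2 \<and> i = i2" using only ij by simp
          then show ?thesis using crossed k1(1) k2(1) v vi by auto
        qed
      qed
      then show ?thesis using tv by blast
    qed
  qed
qed

lemma conjugate:
  obtains w where "w permutes {..<n}" "\<And>i. i < n \<Longrightarrow> blk (w i) = blk i" "D' = map_prod w w ` D"
proof -
  \<comment> \<open>The sum of all block numbers is a convenient bound for each of them, so every
    rook is covered.\<close>
  define m where "m = Suc (\<Sum>i<n. blk i)"
  have bm: "blk i < m" if "i < n" for i
    using member_le_sum[of i "{..<n}" blk] that by (simp add: m_def less_Suc_eq_le)
  obtain w where w: "transversal p w" and img: "\<And>i j. (i, j) \<in> D \<Longrightarrow> blk j < m \<Longrightarrow> (w i, w j) \<in> D'"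
    using conjugating_transversal[of m] by blast
  note wD = transversalD[OF w]
  have "map_prod w w ` D \<subseteq> D'" using img bm rookD(2)[OF rooks(1)] by auto
  moreover have "(i', j') \<in> map_prod w w ` D" if ij: "(i', j') \<in> D'" for i' j'
  proof -
    define j where "j = inv_into UNIV w j'"
    have wj: "w j = j'" unfolding j_def using permutes_inverses(1)[OF wD(1)] by simp
    have jn: "j < n" using wD(2)[of j] wj rookD(2)[OF rooks(2) ij] by simp
    obtain i where i: "(i, j) \<in> D" using row_preimage[OF w, of i' j] ij wj jn by blast
    have "(w i, j') \<in> D'" using img[OF i] bm jn wj by simp
    then have "i' = w i" using rookD(5)[OF rooks(2) ij] by simp
    then show ?thesis using i wj by force
  qed
  ultimately have "D' = map_prod w w ` D" by auto
  then show thesis using that wD(1,3) by blast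
qed

end

section \<open>Permutation matrices: conjugate placements are equivalent\<close>

context blocked
begin

definition pmat :: "(nat \<Rightarrow> nat) \<Rightarrow> 'a::{field,finite} mat" where
  "pmat w = mat n n (\<lambda>(i, j). if i = w j then 1 else 0)"

lemma pmat_carrier [simp]: "pmat w \<in> carrier_mat n n"
  by (simp add: pmat_def)

lemma pmat_mult_left:
  assumes w: "w permutes {..<n}" and "X \<in> carrier_mat n n" "i < n" "j < n"
  shows "(pmat w * X) $$ (i, j) = X $$ (inv_into UNIV w i, j)"
proof -
  have "i = w l \<longleftrightarrow> l = inv_into UNIV w i" for l using permutes_inverses[OF w] by metis
  then have "(pmat w * X) $$ (i, j) = (\<Sum>l<n. if l = inv_into UNIV w i then X $$ (l, j) else 0)"
    unfolding mat_mult_entry[OF pmat_carrier assms(2-4)]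
    using assms by (intro sum.cong) (simp_all add: pmat_def)
  moreover have "inv_into UNIV w i < n" using permutes_in_image[OF permutes_inv[OF w], of i] assms by simp
  ultimately show ?thesis by simp
qed

lemma pmat_mult_right:
  assumes w: "w permutes {..<n}" and "X \<in> carrier_mat n n" "i < n" "j < n"
  shows "(X * pmat w) $$ (i, j) = X $$ (i, w j)"
proof -
  have "(X * pmat w) $$ (i, j) = (\<Sum>l<n. if l = w j then X $$ (i, l) else 0)"
    unfolding mat_mult_entry[OF assms(2) pmat_carrier assms(3,4)]
    using assms by (intro sum.cong) (simp_all add: pmat_def)
  moreover have "w j < n" using permutes_in_image[OF w, of j] assms by simp
  ultimately show ?thesis by simp
qed

lemma pmat_block_diag:
  assumes w: "w permutes {..<n}" and b: "\<And>i. i < n \<Longrightarrow> blk (w i) = blk i"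
  shows "pmat w \<in> block_diag"
proof -
  have *: "pmat u * pmat (inv_into UNIV u) = 1\<^sub>m n" if u: "u permutes {..<n}" for u
  proof (rule sq_eqI)
    fix i j assume ij: "i < n" "j < n"
    have "inv_into UNIV u i < n" using permutes_in_image[OF permutes_inv[OF u], of i] ij by simp
    moreover have "inv_into UNIV u i = inv_into UNIV u j \<longleftrightarrow> i = j" using permutes_inverses[OF u] by metis
    ultimately show "(pmat u * pmat (inv_into UNIV u)) $$ (i, j) = 1\<^sub>m n $$ (i, j)"
      unfolding pmat_mult_left[OF u pmat_carrier ij] using ij by (simp add: pmat_def)
  qed simp_all
  have "pmat w * pmat (inv_into UNIV w) = 1\<^sub>m n" using *[OF w] .
  moreover have "pmat (inv_into UNIV w) * pmat w = 1\<^sub>m n"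
    using *[OF permutes_inv[OF w]] by (simp add: permutes_inv_inv[OF w])
  moreover have "pmat w \<in> upper" using b by (auto simp: upper_def pmat_def)
  ultimately have "pmat w \<in> par" unfolding par_def using pmat_carrier by blast
  then show ?thesis using b by (auto simp: block_diag_def pmat_def)
qed

text \<open>The permutation matrix of \<open>w\<close> lies in R and serves as both \<open>p\<close>
  and \<open>q\<close>.\<close>

lemma conjugate_imp_eqv:
  assumes w: "w permutes {..<n}" and b: "\<And>i. i < n \<Longrightarrow> blk (w i) = blk i"
  shows "eqv (rmat D :: 'a::{field,finite} mat) (rmat (map_prod w w ` D))"
proof -
  have "pmat w * (rmat D :: 'a mat) = rmat (map_prod w w ` D) * pmat w"
  proof (rule sq_eqI)
    fix i j assume ij: "i < n" "j < n"
    have n: "inv_into UNIV w i < n" "w j < n"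
      using permutes_in_image[OF permutes_inv[OF w], of i] permutes_in_image[OF w, of j] ij by simp_all
    have "(w j, i) \<in> map_prod w w ` D \<longleftrightarrow> (j, inv_into UNIV w i) \<in> D"
    proof
      assume "(w j, i) \<in> map_prod w w ` D"
      then obtain a c where "(a, c) \<in> D" "w j = w a" "i = w c" by auto
      then show "(j, inv_into UNIV w i) \<in> D" using permutes_inverses[OF w] by metis
    next
      assume "(j, inv_into UNIV w i) \<in> D"
      moreover have "(w j, i) = map_prod w w (j, inv_into UNIV w i)"
        by (simp add: permutes_inverses(1)[OF w])
      ultimately show "(w j, i) \<in> map_prod w w ` D" by (rule rev_image_eqI)
    qed
    then show "(pmat w * (rmat D :: 'a mat)) $$ (i, j) = (rmat (map_prod w w ` D) * pmat w) $$ (i, j)"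
      unfolding pmat_mult_left[OF w rmat_carrier ij] pmat_mult_right[OF w rmat_carrier ij]
      using ij n by (simp add: rmat_entry)
  qed simp_all
  then show ?thesis unfolding eqv_def
    using block_diag_par[OF pmat_block_diag[OF w b]] by (intro bexI[of _ "pmat w"]) simp_all
qed

end

context small_blocks
begin

lemma eqv_rmat_iff:
  assumes D: "rook D" "rook D'"
  shows "eqv (rmat D :: 'a::{field,finite} mat) (rmat D') \<longleftrightarrow>
    (\<exists>w. w permutes {..<n} \<and> (\<forall>i<n. blk (w i) = blk i) \<and> D' = map_prod w w ` D)"
proof
  assume eqv: "eqv (rmat D :: 'a mat) (rmat D')"
  then obtain p q :: "'a mat" where pq: "p \<in> par" "q \<in> par" "dg p = dg q"
    "low_eq (p * rmat D) (rmat D' * q)" unfolding eqv_def by blast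
  obtain p' q' :: "'a mat" where pq': "p' \<in> par" "q' \<in> par" "dg p' = dg q'"
    "low_eq (p' * rmat D') (rmat D * q')" using eqv_sym[OF eqv] unfolding eqv_def by auto
  \<comment> \<open>The equivalence from \<open>D'\<close> to \<open>D\<close> supplies the reverse
    inequalities between the height sums.\<close>
  interpret conv: rook_equivalence n blk D' D p' q' by unfold_locales (use D pq' in auto)
  interpret small_rook_equivalence n blk D D' p q
    by unfold_locales (use D pq conv.height_sums_le in auto)
  show "\<exists>w. w permutes {..<n} \<and> (\<forall>i<n. blk (w i) = blk i) \<and> D' = map_prod w w ` D"
    using conjugate by metis
next
  assume "\<exists>w. w permutes {..<n} \<and> (\<forall>i<n. blk (w i) = blk i) \<and> D' = map_prod w w ` D"
  then show "eqv (rmat D :: 'a mat) (rmat D')" using conjugate_imp_eqv by blast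
qed

end

subsection \<open>Functionals as matrices\<close>

definition mtrace :: "nat \<Rightarrow> 'a::comm_ring_1 mat \<Rightarrow> 'a" where
  "mtrace n A = (\<Sum>i<n. A $$ (i, i))"

lemma mtrace_mult:
  assumes "A \<in> carrier_mat n n" "B \<in> carrier_mat n n"
  shows "mtrace n (A * B) = (\<Sum>i<n. \<Sum>j<n. A $$ (i, j) * B $$ (j, i))"
  unfolding mtrace_def by (intro sum.cong refl mat_mult_entry[OF assms]) simp_all

lemma mtrace_commute:
  assumes "A \<in> carrier_mat n n" "B \<in> carrier_mat n n"
  shows "mtrace n (A * B) = mtrace n (B * A)"
  unfolding mtrace_mult[OF assms] mtrace_mult[OF assms(2,1)]
  by (subst sum.swap) (simp add: mult.commute)

context blocked
begin

text \<open>Identity diagonal blocks make a block upper triangular matrix unitriangular, because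
  \<open>blk\<close> is monotone; its determinant is 1.\<close>

lemma unipotent_in_par:
  assumes p: "p \<in> upper" "dg p = 1\<^sub>m n" shows "p \<in> par"
proof -
  have c: "p \<in> carrier_mat n n" using p upper_carrier by blast
  have e: "p $$ (i, j) = (if i = j then 1 else 0)" if "i < n" "j < n" "blk i = blk j" for i j
  proof -
    have "dg p $$ (i, j) = (1\<^sub>m n :: 'a mat) $$ (i, j)" using p(2) by simp
    then show ?thesis using that by (simp add: dg_def)
  qed
  have "p $$ (i, j) = 0" if "i < n" "j < i" for i j
  proof (cases "blk j = blk i")
    case True
    then show ?thesis using e[of i j] that by simp
  next
    case False
    then have "blk j < blk i" using blk_mono[of j i] that by simp
    then show ?thesis using p(1) that unfolding upper_def by simp
  qed
  then have "upper_triangular p" unfolding upper_triangular_def carrier_matD[OF c] by blast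
  then have "det p = prod_list (diag_mat p)" using det_upper_triangular c by blast
  also have "diag_mat p = map (\<lambda>_. 1) [0..<n]"
    unfolding diag_mat_def carrier_matD[OF c] by (intro map_cong refl) (simp add: e)
  also have "prod_list \<dots> = (1 :: 'a)" by (induction n) simp_all
  finally have "p \<in> Units (ring_mat TYPE('a) n ())" using det_non_zero_imp_unit[OF c] by simp
  then show ?thesis using p(1) unfolding par_def Units_def ring_mat_simps by blast
qed

end

section \<open>Segments as block numbers\<close>

definition blk_of :: "nat list \<Rightarrow> nat \<Rightarrow> nat" where
  "blk_of ns i = (LEAST k. i < sum_list (take (Suc k) ns))"

lemma sum_list_take_mono: "a \<le> b \<Longrightarrow> sum_list (take a ns) \<le> sum_list (take b (ns :: nat list))"
  by (metis append_take_drop_id le_add1 min.absorb1 sum_list_append take_take)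

lemma blk_of_segment:
  assumes "i < sum_list ns"
  shows "blk_of ns i < length ns" "i \<in> segment ns (blk_of ns i)"
proof -
  let ?P = "\<lambda>k. i < sum_list (take (Suc k) ns)"
  have "?P (length ns)" using assms by simp
  then have P: "?P (blk_of ns i)" unfolding blk_of_def by (rule LeastI)
  have lo: "sum_list (take (blk_of ns i) ns) \<le> i"
  proof (cases "blk_of ns i")
    case (Suc k)
    then have "\<not> ?P k" using not_less_Least[of k ?P] by (simp add: blk_of_def)
    then show ?thesis by (simp add: Suc)
  qed simp
  then show "i \<in> segment ns (blk_of ns i)" using P by (simp add: segment_def)
  show "blk_of ns i < length ns"
    using lo assms by (cases "blk_of ns i < length ns") simp_all
qed

lemma segment_blk_of:
  assumes "i \<in> segment ns k" shows "blk_of ns i = k"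
  unfolding blk_of_def
proof (rule Least_equality)
  show "i < sum_list (take (Suc k) ns)" using assms by (simp add: segment_def)
  fix l assume "i < sum_list (take (Suc l) ns)"
  then show "k \<le> l" using assms sum_list_take_mono[of "Suc l" k ns] by (fastforce simp: segment_def)
qed

lemma segment_iff:
  assumes "k < length ns" shows "i \<in> segment ns k \<longleftrightarrow> i < sum_list ns \<and> blk_of ns i = k"
  using segment_subset[OF assms] segment_blk_of[of i ns k] blk_of_segment(2)[of i ns] by auto

lemma roots_iff: "(i, j) \<in> roots ns \<longleftrightarrow> i < sum_list ns \<and> j < sum_list ns \<and> blk_of ns i < blk_of ns j"
proof
  assume "(i, j) \<in> roots ns"
  then obtain k l where "k < l" "l < length ns" "i \<in> segment ns k" "j \<in> segment ns l"
    unfolding roots_def by blast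
  then show "i < sum_list ns \<and> j < sum_list ns \<and> blk_of ns i < blk_of ns j"
    using segment_iff[of k ns i] segment_iff[of l ns j] by simp
next
  assume "i < sum_list ns \<and> j < sum_list ns \<and> blk_of ns i < blk_of ns j"
  then show "(i, j) \<in> roots ns"
    unfolding roots_def using blk_of_segment[of i ns] blk_of_segment[of j ns]
    by (intro UN_I[of "blk_of ns j"] UN_I[of "blk_of ns i"]) simp_all
qed

lemma diag_positions_iff:
  "(i, j) \<in> diag_positions ns \<longleftrightarrow> i < sum_list ns \<and> j < sum_list ns \<and> blk_of ns i = blk_of ns j"
proof
  assume "(i, j) \<in> diag_positions ns"
  then obtain k where "k < length ns" "i \<in> segment ns k" "j \<in> segment ns k"
    unfolding diag_positions_def by blast
  then show "i < sum_list ns \<and> j < sum_list ns \<and> blk_of ns i = blk_of ns j"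
    using segment_iff[of k ns i] segment_iff[of k ns j] by simp
next
  assume "i < sum_list ns \<and> j < sum_list ns \<and> blk_of ns i = blk_of ns j"
  then show "(i, j) \<in> diag_positions ns" 
    unfolding diag_positions_def using blk_of_segment[of i ns] blk_of_segment[of j ns]
    by (intro UN_I[of "blk_of ns j"]) simp_all
qed

lemma blocked_blk_of: "blocked (sum_list ns) (blk_of ns)"
proof
  fix i j assume "i \<le> j" "j < sum_list ns"
  then have "i < sum_list (take (Suc (blk_of ns j)) ns)"
    using blk_of_segment(2)[of j ns] by (simp add: segment_def)
  then show "blk_of ns i \<le> blk_of ns j" unfolding blk_of_def[of ns i] by (rule Least_le)
qed

lemma small_blocks_blk_of:
  assumes "\<And>m. m \<in> set ns \<Longrightarrow> m \<le> 2" shows "small_blocks (sum_list ns) (blk_of ns)"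
proof -
  interpret blocked "sum_list ns" "blk_of ns" by (rule blocked_blk_of)
  show ?thesis
  proof
    fix i j k assume l: "i < sum_list ns" "j < sum_list ns" "k < sum_list ns"
      and eq: "blk_of ns i = blk_of ns j" "blk_of ns j = blk_of ns k"
    define m where "m = blk_of ns k"
    have mem: "i \<in> segment ns m" "j \<in> segment ns m" "k \<in> segment ns m" and m: "m < length ns"
      using blk_of_segment[OF l(1)] blk_of_segment[OF l(2)] blk_of_segment[OF l(3)] eq by (simp_all add: m_def)
    have "sum_list (take (Suc m) ns) = sum_list (take m ns) + ns ! m"
      using m by (simp add: take_Suc_conv_app_nth)
    moreover have "ns ! m \<le> 2" using assms m by simp
    ultimately show "i = j \<or> j = k \<or> i = k" using mem unfolding segment_def by auto
  qed
qed

section \<open>Dictionary between functionals on J and matrices\<close>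

locale parabolic_type =
  fixes ns :: "nat list"
begin

abbreviation "N \<equiv> sum_list ns"

sublocale blocked N "blk_of ns" by (rule blocked_blk_of)

lemma rook_placement_iff: "rook_placement ns D \<longleftrightarrow> rook D"
  unfolding rook_placement_def rook_def using roots_iff[of _ _ ns] by auto

lemma weyl_conjugate_iff:
  "weyl_conjugate ns D D' \<longleftrightarrow>
    (\<exists>w. w permutes {..<N} \<and> (\<forall>i<N. blk_of ns (w i) = blk_of ns i) \<and> D' = map_prod w w ` D)"
proof -
  have "(\<forall>k<length ns. w ` segment ns k = segment ns k) \<longleftrightarrow> (\<forall>i<N. blk_of ns (w i) = blk_of ns i)"
    if w: "w permutes {..<N}" for w
  proof
    assume *: "\<forall>k<length ns. w ` segment ns k = segment ns k"
    show "\<forall>i<N. blk_of ns (w i) = blk_of ns i"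
    proof (intro allI impI)
      fix i assume "i < N"
      then have "w i \<in> segment ns (blk_of ns i)" using * blk_of_segment[of i ns] by blast
      then show "blk_of ns (w i) = blk_of ns i" by (rule segment_blk_of)
    qed
  next
    assume *: "\<forall>i<N. blk_of ns (w i) = blk_of ns i"
    show "\<forall>k<length ns. w ` segment ns k = segment ns k"
    proof (intro allI impI)
      fix k assume k: "k < length ns"
      have "w ` segment ns k \<subseteq> segment ns k"
        using * permutes_in_image[OF w] by (auto simp: segment_iff[OF k])
      moreover have "inj_on w (segment ns k)" using permutes_inj[OF w] by (rule inj_on_subset) simp
      moreover have "finite (segment ns k)" by (simp add: segment_def)
      ultimately show "w ` segment ns k = segment ns k" using endo_inj_surj by blast
    qed
  qed
  then show ?thesis unfolding weyl_conjugate_def levi_weyl_def by blast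
qed

lemma parabolic_eq: "parabolic ns = par"
proof -
  have "x \<in> parabolic ns \<longleftrightarrow> x \<in> par" for x :: "'a mat"
  proof (cases "x \<in> carrier_mat N N")
    case True
    have "supported_on x (diag_positions ns \<union> roots ns) \<longleftrightarrow> x \<in> upper"
    proof -
      have "(x $$ (i, j) \<noteq> 0 \<longrightarrow> (i, j) \<in> diag_positions ns \<union> roots ns) \<longleftrightarrow>
          (blk_of ns j < blk_of ns i \<longrightarrow> x $$ (i, j) = 0)" if "i < N" "j < N" for i j
        using that by (cases "blk_of ns i" "blk_of ns j" rule: linorder_cases)
          (simp_all add: roots_iff diag_positions_iff)
      then show ?thesis unfolding supported_on_def upper_def carrier_matD[OF True] using True by simp
    qed
    then show ?thesis using True
      unfolding parabolic_def par_def GL_def Units_def ring_mat_simps by blast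
  next
    case False
    then show ?thesis using par_carrier
      unfolding parabolic_def GL_def Units_def ring_mat_simps by blast
  qed
  then show ?thesis by blast
qed

lemma levi_eq: "levi ns = block_diag"
proof -
  have "supported_on x (diag_positions ns) \<longleftrightarrow> (\<forall>i<N. \<forall>j<N. blk_of ns i \<noteq> blk_of ns j \<longrightarrow> x $$ (i, j) = 0)"
    if "x \<in> par" for x :: "'a mat"
    unfolding supported_on_def carrier_matD[OF par_carrier[OF that]]
    by (auto simp: diag_positions_iff)
  then show ?thesis unfolding levi_def parabolic_eq block_diag_def by blast
qed

lemma nilradical_iff:
  "x \<in> nilradical ns \<longleftrightarrow> x \<in> carrier_mat N N \<and>
     (\<forall>i<N. \<forall>j<N. blk_of ns j \<le> blk_of ns i \<longrightarrow> x $$ (i, j) = 0)"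
proof (cases "x \<in> carrier_mat N N")
  case True
  show ?thesis unfolding nilradical_def supported_on_def mem_Collect_eq carrier_matD[OF True]
    using True by (simp add: roots_iff) (meson linorder_not_le)
qed (simp add: nilradical_def)

lemma nilradical_carrier [simp]: "x \<in> nilradical ns \<Longrightarrow> x \<in> carrier_mat N N"
  by (simp add: nilradical_iff)

lemma unipotent_radical_eq: "unipotent_radical ns = {p \<in> par. dg p = 1\<^sub>m N}"
proof (rule subset_antisym; rule subsetI)
  fix p :: "'a mat" assume "p \<in> unipotent_radical ns"
  then obtain x where x: "x \<in> nilradical ns" "p = 1\<^sub>m N + x" unfolding unipotent_radical_def by blast
  have c: "x \<in> carrier_mat N N" using x by simp
  have e: "p $$ (i, j) = (if i = j then 1 else 0) + x $$ (i, j)" if "i < N" "j < N" for i j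
    using that c unfolding x(2) by simp
  have pc: "p \<in> carrier_mat N N" using c by (simp add: x(2))
  have z: "p $$ (i, j) = (if i = j then 1 else 0)" if "i < N" "j < N" "blk_of ns j \<le> blk_of ns i" for i j
    using e[OF that(1,2)] that x(1) unfolding nilradical_iff by simp
  have "p \<in> upper" unfolding upper_def using z pc by fastforce
  moreover have "dg p = 1\<^sub>m N"
    by (rule sq_eqI) (use z in \<open>auto simp: dg_def\<close>)
  ultimately show "p \<in> {p \<in> par. dg p = 1\<^sub>m N}" using unipotent_in_par by blast
next
  fix p :: "'a mat" assume "p \<in> {p \<in> par. dg p = 1\<^sub>m N}"
  then have p: "p \<in> par" "dg p = 1\<^sub>m N" by simp_all
  have c: "p \<in> carrier_mat N N" using p by simp
  define x where "x = mat N N (\<lambda>(i, j). if blk_of ns i < blk_of ns j then p $$ (i, j) else 0)"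
  have "x \<in> nilradical ns" by (simp add: nilradical_iff x_def)
  moreover have "p = 1\<^sub>m N + x"
  proof (rule sq_eqI)
    fix i j assume ij: "i < N" "j < N"
    have "dg p $$ (i, j) = 1\<^sub>m N $$ (i, j)" by (simp only: p(2))
    then show "p $$ (i, j) = (1\<^sub>m N + x) $$ (i, j)"
      using ij par_upper[OF p(1)] unfolding upper_def
      by (cases "blk_of ns i" "blk_of ns j" rule: linorder_cases) (auto simp: x_def dg_def)
  qed (use c in \<open>simp_all add: x_def\<close>)
  ultimately show "p \<in> unipotent_radical ns" unfolding unipotent_radical_def by blast
qed

definition fnl :: "'a::{field,finite} mat \<Rightarrow> 'a mat \<Rightarrow> 'a" where
  "fnl X = (\<lambda>x\<in>nilradical ns. mtrace N (X * x))"

lemma nilradical_mult: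
  assumes x: "x \<in> nilradical ns" and p: "p \<in> par"
  shows "x * p \<in> nilradical ns" "p * x \<in> nilradical ns"
proof -
  have c: "x \<in> carrier_mat N N" "p \<in> carrier_mat N N" using x p by simp_all
  have up: "p $$ (i, j) = 0" if "i < N" "j < N" "blk_of ns j < blk_of ns i" for i j
    using par_upper[OF p] that by (simp add: upper_def)
  have nil: "x $$ (i, j) = 0" if "i < N" "j < N" "blk_of ns j \<le> blk_of ns i" for i j
    using x that by (simp add: nilradical_iff)
  have "x $$ (i, l) * p $$ (l, j) = 0" if "i < N" "j < N" "blk_of ns j \<le> blk_of ns i" "l < N" for i j l
    using up[OF that(4,2)] nil[OF that(1,4)] that(3) by (cases "blk_of ns l \<le> blk_of ns i") simp_all
  then have "(x * p) $$ (i, j) = 0" if "i < N" "j < N" "blk_of ns j \<le> blk_of ns i" for i j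
    unfolding mat_mult_entry[OF c that(1,2)] using that by (intro sum.neutral) simp
  then show "x * p \<in> nilradical ns" unfolding nilradical_iff using c by simp
  have "p $$ (i, l) * x $$ (l, j) = 0" if "i < N" "j < N" "blk_of ns j \<le> blk_of ns i" "l < N" for i j l
    using up[OF that(1,4)] nil[OF that(4,2)] that(3) by (cases "blk_of ns l < blk_of ns i") simp_all
  then have "(p * x) $$ (i, j) = 0" if "i < N" "j < N" "blk_of ns j \<le> blk_of ns i" for i j
    unfolding mat_mult_entry[OF c(2,1) that(1,2)] using that by (intro sum.neutral) simp
  then show "p * x \<in> nilradical ns" unfolding nilradical_iff using c by simp
qed

text \<open>Cyclicity of the trace: \<open>tr (X B x A) = tr (A X B x)\<close>.\<close>

lemma act_fnl:
  assumes A: "A \<in> par" and B: "B \<in> par" and X: "X \<in> carrier_mat N N"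
  shows "left_act ns A (right_act ns (fnl X) B) = fnl (A * X * B)"
proof (rule ext)
  fix x :: "'a mat"
  show "left_act ns A (right_act ns (fnl X) B) x = fnl (A * X * B) x"
  proof (cases "x \<in> nilradical ns")
    case True
    note c = par_carrier[OF A] par_carrier[OF B] X nilradical_carrier[OF True]
    have 1: "x * A \<in> nilradical ns" using nilradical_mult(1)[OF True A] .
    have 2: "B * (x * A) \<in> nilradical ns" using nilradical_mult(2)[OF 1 B] .
    have "left_act ns A (right_act ns (fnl X) B) x = mtrace N (X * (B * (x * A)))"
      using True 1 2 by (simp add: left_act_def right_act_def fnl_def)
    also have "X * (B * (x * A)) = (X * (B * x)) * A" using c by (simp add: sq_assoc)
    also have "mtrace N \<dots> = mtrace N (A * (X * (B * x)))" using c by (intro mtrace_commute) simp_all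
    also have "A * (X * (B * x)) = A * X * B * x" using c by (simp add: sq_assoc)
    also have "mtrace N (A * X * B * x) = fnl (A * X * B) x" using True by (simp add: fnl_def)
    finally show ?thesis .
  qed (simp add: left_act_def fnl_def)
qed

lemma matrix_unit_sum:
  assumes "\<alpha> \<in> {..<N} \<times> {..<N}" "X \<in> carrier_mat N N"
  shows "mtrace N (X * matrix_unit ns \<alpha>) = X $$ (snd \<alpha>, fst \<alpha>)"
proof -
  obtain a b where ab: "\<alpha> = (a, b)" "a < N" "b < N" using assms(1) by (cases \<alpha>) simp
  have c: "matrix_unit ns \<alpha> \<in> carrier_mat N N" by (simp add: matrix_unit_def)
  have "(\<Sum>j<N. X $$ (i, j) * matrix_unit ns \<alpha> $$ (j, i)) = (if i = b then X $$ (i, a) else 0)" if "i < N" for i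
  proof -
    have "(\<Sum>j<N. X $$ (i, j) * matrix_unit ns \<alpha> $$ (j, i)) = (\<Sum>j<N. if j = a then if i = b then X $$ (i, j) else 0 else 0)"
      using that by (intro sum.cong) (simp_all add: matrix_unit_def ab)
    then show ?thesis using ab by simp
  qed
  then have "mtrace N (X * matrix_unit ns \<alpha>) = (\<Sum>i<N. if i = b then X $$ (i, a) else 0)"
    unfolding mtrace_mult[OF assms(2) c] by (intro sum.cong) simp_all
  then show ?thesis using ab by simp
qed

text \<open>The matrix unit of the root \<open>(j, i)\<close> reads off the entry
  \<open>(i, j)\<close>, and conversely the entries of an element of J meet only entries of
  \<open>X\<close> below the block diagonal.\<close>

lemma fnl_eq_iff:
  assumes "X \<in> carrier_mat N N" "Y \<in> carrier_mat N N"
  shows "fnl X = fnl Y \<longleftrightarrow> low_eq X Y"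
proof
  assume eq: "fnl X = fnl Y"
  show "low_eq X Y" unfolding low_eq_def
  proof (intro allI impI)
    fix i j assume ij: "i < N" "j < N" "blk_of ns j < blk_of ns i"
    then have "(matrix_unit ns (j, i) :: 'a mat) \<in> nilradical ns"
      by (intro matrix_unit_in_nilradical) (simp add: roots_iff)
    moreover have "fnl X (matrix_unit ns (j, i)) = fnl Y (matrix_unit ns (j, i))" by (simp only: eq)
    ultimately show "X $$ (i, j) = Y $$ (i, j)"
      using matrix_unit_sum[of "(j, i)" X] matrix_unit_sum[of "(j, i)" Y] assms ij by (simp add: fnl_def)
  qed
next
  assume low: "low_eq X Y"
  show "fnl X = fnl Y"
  proof (rule ext)
    fix x
    show "fnl X x = fnl Y x"
    proof (cases "x \<in> nilradical ns")
      case True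
      have "X $$ (i, j) * x $$ (j, i) = Y $$ (i, j) * x $$ (j, i)" if "i < N" "j < N" for i j
        using low that True unfolding low_eq_def nilradical_iff by (cases "blk_of ns j < blk_of ns i") simp_all
      then have "(\<Sum>i<N. \<Sum>j<N. X $$ (i, j) * x $$ (j, i)) = (\<Sum>i<N. \<Sum>j<N. Y $$ (i, j) * x $$ (j, i))"
        by (intro sum.cong refl) (simp only: lessThan_iff)
      then show ?thesis using True assms by (simp add: fnl_def mtrace_mult)
    qed (simp add: fnl_def)
  qed
qed

lemma dual_imp_fnl:
  fixes f :: "'a::{field,finite} mat \<Rightarrow> 'a"
  assumes f: "f \<in> dual ns"
  obtains X where "X \<in> carrier_mat N N" "f = fnl X"
proof -
  have add: "f (x + y) = f x + f y" if "x \<in> nilradical ns" "y \<in> nilradical ns" for x y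
    using f that unfolding dual_def by blast
  have smult: "f (c \<cdot>\<^sub>m x) = c * f x" if "x \<in> nilradical ns" for c x
    using f that unfolding dual_def by blast
  define X where "X = mat N N (\<lambda>(i, j). if (j, i) \<in> roots ns then f (matrix_unit ns (j, i)) else 0)"
  have Xc: "X \<in> carrier_mat N N" by (simp add: X_def)
  \<comment> \<open>Membership in \<open>dual\<close> gives additivity for two summands, so the
    expansion of \<open>x\<close> in matrix units is built up root by root.\<close>
  have partial: "f (mat N N (\<lambda>\<beta>. if \<beta> \<in> S then x $$ \<beta> else 0)) = (\<Sum>\<beta>\<in>S. x $$ \<beta> * f (matrix_unit ns \<beta>))"
    if "finite S" "S \<subseteq> roots ns" for S and x :: "'a mat"
    using that
  proof (induction S rule: finite_induct)
    case empty
    have z: "(0\<^sub>m N N :: 'a mat) \<in> nilradical ns" by (simp add: nilradical_iff)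
    have "f (0 \<cdot>\<^sub>m 0\<^sub>m N N) = 0" using smult[OF z, of 0] by simp
    moreover have "mat N N (\<lambda>\<beta>. if \<beta> \<in> {} then x $$ \<beta> else 0) = 0 \<cdot>\<^sub>m 0\<^sub>m N N"
      by (rule sq_eqI) simp_all
    ultimately show ?case by simp
  next
    case (insert \<alpha> S)
    let ?y = "mat N N (\<lambda>\<beta>. if \<beta> \<in> S then x $$ \<beta> else 0)"
    have y: "?y \<in> nilradical ns" unfolding nilradical_iff using insert.prems roots_iff[of _ _ ns] by auto
    have u: "(matrix_unit ns \<alpha> :: 'a mat) \<in> nilradical ns"
      using insert.prems by (intro matrix_unit_in_nilradical) simp
    then have u': "x $$ \<alpha> \<cdot>\<^sub>m matrix_unit ns \<alpha> \<in> nilradical ns" unfolding nilradical_iff by auto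
    have "mat N N (\<lambda>\<beta>. if \<beta> \<in> insert \<alpha> S then x $$ \<beta> else 0) = x $$ \<alpha> \<cdot>\<^sub>m matrix_unit ns \<alpha> + ?y"
      by (rule sq_eqI) (use insert.hyps in \<open>auto simp: matrix_unit_def\<close>)
    then show ?case using insert add[OF u' y] smult[OF u] by simp
  qed
  have "f x = fnl X x" if x: "x \<in> nilradical ns" for x
  proof -
    have fin: "finite (roots ns)" by (rule finite_subset[OF roots_subset]) simp
    have "x = mat N N (\<lambda>\<beta>. if \<beta> \<in> roots ns then x $$ \<beta> else 0)"
      by (rule sq_eqI) (use x in \<open>auto simp: nilradical_iff roots_iff\<close>)
    then have "f x = (\<Sum>\<beta>\<in>roots ns. x $$ \<beta> * f (matrix_unit ns \<beta>))"
      using partial[OF fin subset_refl, of x] by simp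
    also have "\<dots> = (\<Sum>\<beta>\<in>{..<N} \<times> {..<N}. if \<beta> \<in> roots ns then x $$ \<beta> * f (matrix_unit ns \<beta>) else 0)"
      using roots_subset[of ns] by (simp add: sum.inter_restrict[symmetric] Int_absorb1)
    also have "\<dots> = (\<Sum>j<N. \<Sum>i<N. X $$ (i, j) * x $$ (j, i))"
      unfolding sum.cartesian_product by (intro sum.cong) (auto simp: X_def)
    also have "\<dots> = mtrace N (X * x)"
      using sum.swap[of "\<lambda>j i. X $$ (i, j) * x $$ (j, i)"] x Xc by (simp add: mtrace_mult)
    finally show ?thesis using x by (simp add: fnl_def)
  qed
  \<comment> \<open>Outside J both functions are \<open>undefined\<close> by extensionality.\<close>
  moreover have "f x = fnl X x" if "x \<notin> nilradical ns" for x
    using f that by (simp add: dual_def fnl_def extensional_def)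
  ultimately have "f = fnl X" by blast
  then show thesis using that Xc by blast
qed

lemma rook_functional_eq:
  assumes D: "rook D"
  shows "rook_functional ns D = (fnl (rmat D) :: 'a::{field,finite} mat \<Rightarrow> 'a)"
proof
  fix x :: "'a mat"
  have sub: "D \<subseteq> {..<N} \<times> {..<N}" using rookD(1,2)[OF D] by auto
  have "(\<Sum>\<alpha>\<in>D. dual_unit ns \<alpha> x) = mtrace N (rmat D * x)" if x: "x \<in> nilradical ns"
  proof -
    have "(\<Sum>\<alpha>\<in>D. dual_unit ns \<alpha> x) = (\<Sum>\<alpha>\<in>{..<N} \<times> {..<N}. if \<alpha> \<in> D then x $$ \<alpha> else 0)"
      using sub x by (simp add: dual_unit_def sum.inter_restrict[symmetric] Int_absorb1)
    also have "\<dots> = (\<Sum>j<N. \<Sum>i<N. rmat D $$ (i, j) * x $$ (j, i))"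
      unfolding sum.cartesian_product by (intro sum.cong) (auto simp: rmat_entry)
    also have "\<dots> = mtrace N (rmat D * x)"
      using sum.swap[of "\<lambda>j i. rmat D $$ (i, j) * x $$ (j, i)"] x by (simp add: mtrace_mult)
    finally show ?thesis .
  qed
  then show "rook_functional ns D x = fnl (rmat D) x" by (simp add: rook_functional_def fnl_def)
qed

lemma block_diag_inv:
  assumes "r \<in> block_diag"
  shows "inv\<^bsub>mat_ring N\<^esub> r \<in> block_diag" "r * inv\<^bsub>mat_ring N\<^esub> r = 1\<^sub>m N" "inv\<^bsub>mat_ring N\<^esub> r * r = 1\<^sub>m N"
proof -
  obtain r' where r': "r' \<in> block_diag" "r * r' = 1\<^sub>m N" "r' * r = 1\<^sub>m N" using block_diag_inverse[OF assms] .
  interpret M: ring "ring_mat TYPE('a) N ()" by (rule ring_mat)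
  have "inv\<^bsub>mat_ring N\<^esub> r = r'"
    using M.inv_char[of r r'] r' assms by (simp add: ring_mat_simps)
  then show "inv\<^bsub>mat_ring N\<^esub> r \<in> block_diag" "r * inv\<^bsub>mat_ring N\<^esub> r = 1\<^sub>m N" "inv\<^bsub>mat_ring N\<^esub> r * r = 1\<^sub>m N"
    using r' by simp_all
qed

text \<open>From \<open>r\<close>, \<open>a\<close>, \<open>b\<close> one takes
  \<open>p = r a\<close> and \<open>q = r b^-1\<close>. Conversely \<open>r = dg p\<close>,
  \<open>a = r^-1 p\<close> and \<open>b = q^-1 r\<close>: then \<open>r a = p\<close> and
  \<open>b r^-1 = q^-1\<close>, while \<open>dg p = dg q\<close> puts \<open>a\<close> and
  \<open>b\<close> into N.\<close>

lemma equivalent_fnl_iff: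
  assumes X: "X \<in> carrier_mat N N" and Y: "Y \<in> carrier_mat N N"
  shows "equivalent ns (fnl X) (fnl Y) \<longleftrightarrow> eqv X Y"
proof
  assume "equivalent ns (fnl X) (fnl Y)"
  then obtain r a b where r: "r \<in> block_diag" and a: "a \<in> par" "dg a = 1\<^sub>m N" and b: "b \<in> par" "dg b = 1\<^sub>m N"
    and eq: "fnl Y = left_act ns (r * a) (right_act ns (fnl X) (b * inv\<^bsub>mat_ring N\<^esub> r))"
    unfolding equivalent_def levi_eq unipotent_radical_eq by blast
  define r' where "r' = inv\<^bsub>mat_ring N\<^esub> r"
  have r': "r' \<in> block_diag" "r * r' = 1\<^sub>m N" "r' * r = 1\<^sub>m N"
    using block_diag_inv[OF r] by (simp_all add: r'_def)
  obtain b' where b': "b' \<in> par" "b * b' = 1\<^sub>m N" "b' * b = 1\<^sub>m N" using par_inverse[OF b(1)] .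
  note c = block_diag_carrier[OF r] block_diag_carrier[OF r'(1)] par_carrier[OF a(1)] par_carrier[OF b(1)]
    par_carrier[OF b'(1)]
  have ra: "r * a \<in> par" and br: "b * r' \<in> par" and rb: "r * b' \<in> par"
    using par_mult block_diag_par r r' a b b' by blast+
  have "fnl Y = fnl (r * a * X * (b * r'))"
    using act_fnl[OF ra br X] eq by (simp add: r'_def)
  then have "low_eq Y (r * a * X * (b * r'))" using fnl_eq_iff[OF Y] c X by simp
  then have "low_eq (Y * (r * b')) (r * a * X * (b * r') * (r * b'))"
    by (rule low_eq_mult_right[OF _ par_upper[OF rb] Y]) (use c X in simp)
  moreover have "b * (r' * (r * b')) = 1\<^sub>m N"
    using cancel_inverse[OF c(1,2,5) r'(3)] b'(2) by simp
  then have "r * a * X * (b * r') * (r * b') = r * a * X"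
    using c X by (simp add: sq_assoc)
  ultimately have "low_eq (r * a * X) (Y * (r * b'))" using low_eq_sym by simp
  moreover have "dg b' = 1\<^sub>m N"
    using dg_mult[OF par_upper[OF b(1)] par_upper[OF b'(1)]] b b' by simp
  then have "dg (r * a) = dg (r * b')"
    using dg_mult[OF par_upper[OF block_diag_par[OF r]] par_upper[OF a(1)]]
      dg_mult[OF par_upper[OF block_diag_par[OF r]] par_upper[OF b'(1)]] a by simp
  ultimately show "eqv X Y" unfolding eqv_def using ra rb by blast
next
  assume "eqv X Y"
  then obtain p q where pq: "p \<in> par" "q \<in> par" "dg p = dg q" and low: "low_eq (p * X) (Y * q)"
    unfolding eqv_def by blast
  obtain q' where q': "q' \<in> par" "q * q' = 1\<^sub>m N" "q' * q = 1\<^sub>m N" using par_inverse[OF pq(2)] .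
  define r where "r = dg p"
  define r' where "r' = inv\<^bsub>mat_ring N\<^esub> r"
  have r: "r \<in> block_diag" unfolding r_def by (rule dg_in_block_diag[OF pq(1)])
  have r': "r' \<in> block_diag" "r * r' = 1\<^sub>m N" "r' * r = 1\<^sub>m N"
    using block_diag_inv[OF r] by (simp_all add: r'_def)
  note c = block_diag_carrier[OF r] block_diag_carrier[OF r'(1)] par_carrier[OF pq(1)] par_carrier[OF pq(2)]
    par_carrier[OF q'(1)]
  note rp = block_diag_par[OF r] block_diag_par[OF r'(1)]
  have a: "r' * p \<in> par" "dg (r' * p) = 1\<^sub>m N"
    using par_mult[OF rp(2) pq(1)] dg_mult[OF par_upper[OF rp(2)] par_upper[OF pq(1)]]
      dg_block_diag[OF r'(1)] r' by (simp_all add: r_def)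
  have b: "q' * r \<in> par" "dg (q' * r) = 1\<^sub>m N"
    using par_mult[OF q'(1) rp(1)] dg_mult[OF par_upper[OF q'(1)] par_upper[OF rp(1)]]
      dg_mult[OF par_upper[OF q'(1)] par_upper[OF pq(2)]] dg_block_diag[OF r] pq(3) q'
    by (simp_all add: r_def)
  have ra: "r * (r' * p) = p" using cancel_inverse[OF c(2,1,3) r'(2)] .
  have br: "q' * r * r' = q'" using c r' by (simp add: sq_assoc)
  have "low_eq (p * X * q') (Y * q * q')"
    by (rule low_eq_mult_right[OF low par_upper[OF q'(1)]]) (use c X Y in simp_all)
  moreover have "Y * q * q' = Y" using c Y q' by (simp add: sq_assoc)
  ultimately have "low_eq Y (p * X * q')" using low_eq_sym by simp
  then have "fnl Y = fnl (p * X * q')" using fnl_eq_iff[OF Y] c X by simp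
  also have "\<dots> = left_act ns (r * (r' * p)) (right_act ns (fnl X) (q' * r * r'))"
    using act_fnl[OF pq(1) q'(1) X] by (simp only: ra br)
  finally show "equivalent ns (fnl X) (fnl Y)"
    unfolding equivalent_def levi_eq unipotent_radical_eq r'_def using r a b by (auto simp: r'_def)
qed

end

theorem theorem4p5:
  fixes ns :: "nat list"
  assumes "ns \<noteq> []" and "\<forall>m\<in>set ns. 1 \<le> m \<and> m \<le> 2"
  shows "(\<forall>f \<in> (dual ns :: ('q::{field,finite} mat \<Rightarrow> 'q) set).
            \<exists>D. rook_placement ns D \<and> equivalent ns f (rook_functional ns D)) \<and>
         (\<forall>D D'. rook_placement ns D \<and> rook_placement ns D' \<longrightarrow>
            (equivalent ns (rook_functional ns D :: 'q mat \<Rightarrow> 'q) (rook_functional ns D')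
               \<longleftrightarrow> weyl_conjugate ns D D'))"
proof -
  interpret T: parabolic_type ns .
  interpret small_blocks "sum_list ns" "blk_of ns"
    by (rule small_blocks_blk_of) (use assms(2) in blast)
  have "\<exists>D. rook_placement ns D \<and> equivalent ns f (rook_functional ns D)"
    if f: "f \<in> dual ns" for f :: "'q mat \<Rightarrow> 'q"
  proof -
    obtain X where X: "X \<in> carrier_mat (sum_list ns) (sum_list ns)" "f = T.fnl X"
      using T.dual_imp_fnl[OF f] .
    obtain D where D: "T.rook D" "T.eqv X (T.rmat D)" using rook_representative[OF X(1)] .
    have "equivalent ns f (rook_functional ns D)"
      unfolding X(2) T.rook_functional_eq[OF D(1)] T.equivalent_fnl_iff[OF X(1) T.rmat_carrier] by (rule D(2))
    then show ?thesis using D(1) T.rook_placement_iff by blast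
  qed
  moreover have "equivalent ns (rook_functional ns D :: 'q mat \<Rightarrow> 'q) (rook_functional ns D')
      \<longleftrightarrow> weyl_conjugate ns D D'" if "rook_placement ns D" "rook_placement ns D'" for D D'
  proof -
    have D: "T.rook D" "T.rook D'" using that T.rook_placement_iff by blast+
    show ?thesis
      unfolding T.rook_functional_eq[OF D(1)] T.rook_functional_eq[OF D(2)]
        T.equivalent_fnl_iff[OF T.rmat_carrier T.rmat_carrier] T.weyl_conjugate_iff
      by (rule eqv_rmat_iff[OF D])
  qed
  ultimately show ?thesis by blast
qed

end
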